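(* For every $\lambda\in(0,1)$, $$ \dim_{\mathrm{hyp}}(F_{1-\lambda})=\dim_H(\Omega_\lambda)=\begin{cases}-\dfrac{\log4}{\log[\lambda(1-\lambda)]} & \text{if }\lambda\le\frac12,\\[2mm] 1 & \text{if }\lambda\ge\frac12.\end{cases} $$
   Context: For $\lambda\in(0,1)$ and $n\ge1$ let $W_n:=(\lambda^n,\lambda^{n-1}]$, and define $F_\lambda:(0,1]\to(0,1]$ by $F_\lambda(x)=\frac{x-\lambda}{1-\lambda}$ if $x\in W_1$ and $F_\lambda(x)=\frac{x-\lambda^n}{\lambda(1-\lambda)}$ if $x\in W_n$, $n\ge2$. $\dim_H$ is Hausdorff dimension. The hyperbolic dimension is $\dim_{\mathrm{hyp}}(F_\lambda):=\sup\{\dim_H(\Lambda):\Lambda\text{ is compact, }F_\lambda\text{-invariant and }0\notin\Lambda\}$, the supremum being over compact sets $\Lambda\subset(0,1]$ with $F_\lambda(\Lambda)\subset\Lambda$. The escaping set is $\Omega_\lambda:=\{x\in(0,1]:\lim_{n\to\infty}F_\lambda^n(x)=0\}$. *)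

theory Defs
  imports "HOL-Analysis.Analysis"
begin

(* For nonempty U this is (diam U)^s with the convention 0^0 = 1 (in the library, 0 powr 0 = 0),
   so that the 0-dimensional Hausdorff measure is the counting measure. *)
definition diam_power :: "real \<Rightarrow> 'a::metric_space set \<Rightarrow> ennreal" where
  "diam_power s U =
     (if U = {} then 0 else if s = 0 then 1 else ennreal (diameter U powr s))"

(* Boundedness is required explicitly: the library's diameter of an unbounded set is not infinite. *)
definition delta_covers :: "real \<Rightarrow> 'a::metric_space set \<Rightarrow> (nat \<Rightarrow> 'a set) set" where
  "delta_covers \<delta> A =
     {U. A \<subseteq> (\<Union>i. U i) \<and> (\<forall>i. bounded (U i) \<and> diameter (U i) \<le> \<delta>)}"

definition hausdorff_premeasure :: "real \<Rightarrow> real \<Rightarrow> 'a::metric_space set \<Rightarrow> ennreal" where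
  "hausdorff_premeasure s \<delta> A = (INF U\<in>delta_covers \<delta> A. \<Sum>i. diam_power s (U i))"

definition hausdorff_measure :: "real \<Rightarrow> 'a::metric_space set \<Rightarrow> ennreal" where
  "hausdorff_measure s A = (SUP \<delta>\<in>{0<..}. hausdorff_premeasure s \<delta> A)"

definition hausdorff_dim :: "'a::metric_space set \<Rightarrow> ereal" where
  "hausdorff_dim A = Inf {ereal s | s. 0 \<le> s \<and> hausdorff_measure s A = 0}"

definition W :: "real \<Rightarrow> nat \<Rightarrow> real set" where
  "W lam n = {lam ^ n <.. lam ^ (n - 1)}"

(* Only the values on (0,1] are meaningful, where the index n is unique
   (see the lemmas F_W1, F_Wn and W_cover below). *)
definition F :: "real \<Rightarrow> real \<Rightarrow> real" where
  "F lam x =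
     (if x \<in> W lam 1 then (x - lam) / (1 - lam)
      else (let n = (THE n. 2 \<le> n \<and> x \<in> W lam n) in (x - lam ^ n) / (lam * (1 - lam))))"

definition hyperbolic_dim :: "(real \<Rightarrow> real) \<Rightarrow> ereal" where
  "hyperbolic_dim f =
     Sup {hausdorff_dim \<Lambda> | \<Lambda>. compact \<Lambda> \<and> \<Lambda> \<subseteq> {0<..1} \<and> f ` \<Lambda> \<subseteq> \<Lambda>}"

definition escaping_set :: "real \<Rightarrow> real set" where
  "escaping_set lam = {x \<in> {0<..1}. (\<lambda>n. (F lam ^^ n) x) \<longlonglongrightarrow> 0}"

lemma W_unique:
  assumes "0 < lam" "lam < 1" "1 \<le> m" "1 \<le> n" "x \<in> W lam m" "x \<in> W lam n"
  shows "m = n"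
proof -
  have *: False if "1 \<le> i" "i < j" "x \<in> W lam i" "x \<in> W lam j" for i j
  proof -
    have "lam ^ (j - 1) \<le> lam ^ i"
      using assms(1,2) that(2) by (intro power_decreasing) auto
    with that(3,4) show False by (auto simp: W_def)
  qed
  show ?thesis using *[of m n] *[of n m] assms by (meson linorder_neqE_nat)
qed

lemma W_cover:
  assumes "0 < lam" "lam < 1"
  shows "(\<Union>n\<in>{1..}. W lam n) = {0<..1}"
proof (intro equalityI subsetI)
  fix x assume "x \<in> (\<Union>n\<in>{1..}. W lam n)"
  then obtain n where "lam ^ n < x" "x \<le> lam ^ (n - 1)" by (auto simp: W_def)
  moreover have "0 < lam ^ n" "lam ^ (n - 1) \<le> 1"
    using assms by (auto intro: power_le_one)
  ultimately show "x \<in> {0<..1}" by auto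
next
  fix x :: real assume x: "x \<in> {0<..1}"
  then have ex: "\<exists>n. lam ^ n < x" using assms real_arch_pow_inv[of x lam] by auto
  define n where "n = (LEAST n. lam ^ n < x)"
  have n: "lam ^ n < x" unfolding n_def using ex by (rule LeastI_ex)
  have "n \<noteq> 0" using n x by (intro notI) simp
  moreover have "\<not> lam ^ (n - 1) < x"
    using \<open>n \<noteq> 0\<close> not_less_Least[of "n - 1" "\<lambda>n. lam ^ n < x"] by (simp add: n_def)
  ultimately show "x \<in> (\<Union>n\<in>{1..}. W lam n)"
    using n by (intro UN_I[of n]) (auto simp: W_def)
qed

lemma F_W1: "x \<in> W lam 1 \<Longrightarrow> F lam x = (x - lam) / (1 - lam)"
  by (simp add: F_def)

lemma F_Wn:
  assumes "0 < lam" "lam < 1" "2 \<le> n" "x \<in> W lam n"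
  shows "F lam x = (x - lam ^ n) / (lam * (1 - lam))"
proof -
  have "x \<notin> W lam 1" using W_unique[of lam n 1 x] assms by auto
  moreover have "(THE n. 2 \<le> n \<and> x \<in> W lam n) = n"
    using assms W_unique[of lam _ n x] by (intro the_equality) auto
  ultimately show ?thesis by (simp add: F_def)
qed

end

theory Submission
  imports Defs "HOL-Real_Asymp.Real_Asymp"
begin

text \<open>Call \<open>n\<close> the level of \<open>x \<in> W lam n\<close>. A level \<open>n \<ge> 2\<close> may be followed by every level
  \<open>n - 1 + j\<close>, \<open>j \<ge> 0\<close>, and the branch contracts by \<open>lam * (1 - lam)\<close>; level \<open>1\<close> may be followed by
  every level and contracts by \<open>1 - lam\<close>. The upper bounds cover by cylinders and weight level \<open>n\<close>
  with \<open>(1/2) ^ n\<close>: escaping points eventually have levels \<open>\<ge> 2\<close>, and points of an invariant compact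
  set have bounded levels.

  For the lower bounds, a point that starts at level \<open>1\<close> and makes the jumps \<open>j 0, j 1, \<dots>\<close> is
  \<open>lam * (\<Sum>k. (1 - lam) ^ k * lam ^ (j 0 + \<dots> + j (k - 1)))\<close>, whatever the visits to level \<open>1\<close>.
  Concatenating arbitrary blocks of length \<open>m\<close> with jump sum \<open>J\<close> gives a homogeneous Cantor set
  with \<open>(J + m - 1) choose J\<close> children of relative size \<open>(1 - lam) ^ m * lam ^ J\<close>. Its orbits are bounded
  away from \<open>0\<close> if \<open>J \<le> m\<close> and escape if \<open>J > m\<close>. The optimal ratio \<open>J / m\<close> is found by averaging
  over the binomial distribution with parameter \<open>lam\<close> if this respects the constraint, and is
  \<open>J / m \<rightarrow> 1\<close> otherwise; this produces the two cases of the formula.\<close>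

subsection \<open>Hausdorff measure and dimension\<close>

lemma diam_power_pos: "0 < s \<Longrightarrow> diam_power s U = ennreal (diameter U powr s)"
  by (auto simp: diam_power_def)

lemma hausdorff_premeasure_mono:
  "A \<subseteq> B \<Longrightarrow> hausdorff_premeasure s \<delta> A \<le> hausdorff_premeasure s \<delta> B"
  unfolding hausdorff_premeasure_def delta_covers_def by (rule INF_superset_mono) auto

lemma hausdorff_premeasure_antimono:
  "\<delta> \<le> \<delta>' \<Longrightarrow> hausdorff_premeasure s \<delta>' A \<le> hausdorff_premeasure s \<delta> A"
  unfolding hausdorff_premeasure_def delta_covers_def by (rule INF_superset_mono) (auto intro: order_trans)

lemma hausdorff_premeasure_le_cover:
  assumes "A \<subseteq> (\<Union>i. U i)" "\<And>i. bounded (U i)" "\<And>i. diameter (U i) \<le> \<delta>"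
  shows "hausdorff_premeasure s \<delta> A \<le> (\<Sum>i. diam_power s (U i))"
  unfolding hausdorff_premeasure_def delta_covers_def by (rule INF_lower) (use assms in auto)

lemma hausdorff_premeasure_le_diam_power:
  assumes "bounded U" "diameter U \<le> \<delta>"
  shows "hausdorff_premeasure s \<delta> U \<le> diam_power s U"
proof -
  let ?V = "\<lambda>i::nat. if i = 0 then U else {}"
  have "hausdorff_premeasure s \<delta> U \<le> (\<Sum>i. diam_power s (?V i))"
    using assms diameter_ge_0[of U] by (intro hausdorff_premeasure_le_cover) (auto split: if_splits)
  also have "\<dots> = (\<Sum>i\<in>{0}. diam_power s (?V i))"
    by (rule suminf_finite) (auto simp: diam_power_def)
  finally show ?thesis by simp
qed

lemma hausdorff_premeasure_empty: "0 \<le> \<delta> \<Longrightarrow> hausdorff_premeasure s \<delta> {} = 0"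
  using hausdorff_premeasure_le_diam_power[of "{}" \<delta> s] by (simp add: diam_power_def)

text \<open>Covers of the pieces with errors \<open>e * (1/2) ^ Suc n\<close> are merged along
  \<open>prod_decode\<close>. The scale \<delta> stays fixed, because the inductive covering
  estimate works at one scale at a time.\<close>

lemma hausdorff_premeasure_UN_le:
  fixes A :: "nat \<Rightarrow> 'a::metric_space set"
  shows "hausdorff_premeasure s \<delta> (\<Union>i. A i) \<le> (\<Sum>i. hausdorff_premeasure s \<delta> (A i))"
proof (rule ennreal_le_epsilon)
  let ?P = "hausdorff_premeasure s \<delta>"
  fix e :: real
  assume "0 < e" "(\<Sum>n. ?P (A n)) < top"
  then have *: "?P (A n) < ?P (A n) + e * (1/2)^Suc n" for n
    by (auto simp add: less_top dest!: ennreal_suminf_lessD)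
  have "\<exists>U. U \<in> delta_covers \<delta> (A n) \<and> (\<Sum>i. diam_power s (U i)) \<le> ?P (A n) + e * (1/2)^Suc n" for n
    using *[of n] unfolding hausdorff_premeasure_def[of s \<delta> "A n"] INF_less_iff
    by (metis less_imp_le hausdorff_premeasure_def)
  then obtain B where B: "\<And>n. B n \<in> delta_covers \<delta> (A n)"
    and Ble: "\<And>n. (\<Sum>i. diam_power s (B n i)) \<le> ?P (A n) + e * (1/2)^Suc n"
    by metis
  define C where "C = case_prod B o prod_decode"
  have "?P (\<Union>i. A i) \<le> (\<Sum>i. diam_power s (C i))"
  proof (rule hausdorff_premeasure_le_cover)
    show "(\<Union>i. A i) \<subseteq> (\<Union>i. C i)"
    proof safe
      fix x i assume "x \<in> A i"
      then obtain j where "x \<in> B i j" using B[of i] by (auto simp: delta_covers_def)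
      then have "x \<in> C (prod_encode (i, j))" by (simp add: C_def)
      then show "x \<in> (\<Union>i. C i)" by blast
    qed
  qed (use B in \<open>auto simp: C_def delta_covers_def split: prod.split\<close>)
  also have "\<dots> = (\<Sum>i. ((\<lambda>(a, b). diam_power s (B a b)) \<circ> prod_decode) i)"
    by (simp add: C_def split_def)
  also have "\<dots> = (\<Sum>n. \<Sum>i. diam_power s (B n i))"
    using suminf_ennreal_2dimen[of "\<lambda>n. \<Sum>i. diam_power s (B n i)" "\<lambda>(a, b). diam_power s (B a b)"]
    by (simp add: comp_def)
  also have "\<dots> \<le> (\<Sum>n. ?P (A n) + e * (1/2) ^ Suc n)"
    by (intro suminf_le Ble) auto
  also have "\<dots> = (\<Sum>n. ?P (A n)) + (\<Sum>n. ennreal e * ennreal ((1/2) ^ Suc n))"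
    using \<open>0 < e\<close> by (subst suminf_add[symmetric])
      (auto simp del: ennreal_suminf_cmult simp add: ennreal_mult[symmetric])
  also have "\<dots> = (\<Sum>n. ?P (A n)) + e"
    unfolding ennreal_suminf_cmult
    by (subst suminf_ennreal_eq[OF zero_le_power power_half_series]) auto
  finally show "?P (\<Union>i. A i) \<le> (\<Sum>n. ?P (A n)) + e" .
qed

text \<open>The images of the cover elements, cut down to \<open>A\<close>, cover the image. The
  scale changes by the same factor \<open>c\<close>, so iteration along inverse branches keeps track
  of it.\<close>

lemma hausdorff_premeasure_image_le:
  fixes f :: "'a::metric_space \<Rightarrow> 'b::metric_space"
  assumes "0 < s" "0 < c" and lip: "\<And>x y. x \<in> A \<Longrightarrow> y \<in> A \<Longrightarrow> dist (f x) (f y) \<le> c * dist x y"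
  shows "hausdorff_premeasure s (c * \<delta>) (f ` A) \<le> ennreal (c powr s) * hausdorff_premeasure s \<delta> A"
proof -
  let ?c = "ennreal (c powr s)"
  have c: "0 < ?c" "?c < top" using assms by auto
  \<comment> \<open>Dividing by the constant isolates the infimum on the right, so that one cover
    can be treated at a time.\<close>
  have "hausdorff_premeasure s (c * \<delta>) (f ` A) / ?c \<le> hausdorff_premeasure s \<delta> A"
    unfolding hausdorff_premeasure_def[of s \<delta> A]
  proof (rule INF_greatest)
    fix U assume U: "U \<in> delta_covers \<delta> A"
    have diam: "bounded (f ` (U i \<inter> A)) \<and> diameter (f ` (U i \<inter> A)) \<le> c * diameter (U i)" for i
    proof -
      have b: "bounded (U i)" using U by (auto simp: delta_covers_def)
      have d: "dist (f x) (f y) \<le> c * diameter (U i)" if "x \<in> U i \<inter> A" "y \<in> U i \<inter> A" for x y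
      proof -
        have "dist (f x) (f y) \<le> c * dist x y" using that lip by auto
        also have "\<dots> \<le> c * diameter (U i)"
          using diameter_bounded_bound[OF b] that \<open>0 < c\<close> by (intro mult_left_mono) auto
        finally show ?thesis .
      qed
      show ?thesis
      proof
        show "bounded (f ` (U i \<inter> A))"
          unfolding bounded_two_points using d by blast
        show "diameter (f ` (U i \<inter> A)) \<le> c * diameter (U i)"
        proof (cases "U i \<inter> A = {}")
          case True
          then show ?thesis using diameter_ge_0[OF b] \<open>0 < c\<close> by simp
        next
          case False
          then have "(SUP (x, y)\<in>f ` (U i \<inter> A) \<times> f ` (U i \<inter> A). dist x y) \<le> c * diameter (U i)"
            using d by (intro cSUP_least) auto
          then show ?thesis using False by (simp add: diameter_def[of "f ` _"])
        qed
      qed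
    qed
    have "hausdorff_premeasure s (c * \<delta>) (f ` A) \<le> (\<Sum>i. diam_power s (f ` (U i \<inter> A)))"
    proof (rule hausdorff_premeasure_le_cover)
      show "f ` A \<subseteq> (\<Union>i. f ` (U i \<inter> A))" using U unfolding delta_covers_def by blast
      fix i
      have "diameter (U i) \<le> \<delta>" using U by (auto simp: delta_covers_def)
      then show "diameter (f ` (U i \<inter> A)) \<le> c * \<delta>"
        using diam[of i] \<open>0 < c\<close> by (meson less_imp_le mult_left_mono order_trans)
    qed (use diam in auto)
    also have "\<dots> \<le> (\<Sum>i. ?c * diam_power s (U i))"
    proof (intro suminf_le)
      fix i
      have "bounded (U i)" using U by (auto simp: delta_covers_def)
      then have "diameter (f ` (U i \<inter> A)) powr s \<le> (c * diameter (U i)) powr s"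
        using diam[of i] assms diameter_ge_0 by (intro powr_mono2) auto
      also have "\<dots> = c powr s * diameter (U i) powr s" by (rule powr_mult)
      finally show "diam_power s (f ` (U i \<inter> A)) \<le> ?c * diam_power s (U i)"
        using \<open>0 < s\<close> by (simp add: diam_power_pos ennreal_mult[symmetric] ennreal_leI)
    qed auto
    also have "\<dots> = (\<Sum>i. diam_power s (U i)) * ?c" by (simp add: mult.commute)
    finally show "hausdorff_premeasure s (c * \<delta>) (f ` A) / ?c \<le> (\<Sum>i. diam_power s (U i))"
      using c by (intro divide_le_posI_ennreal) (auto simp: mult.commute)
  qed
  then have "?c * (hausdorff_premeasure s (c * \<delta>) (f ` A) / ?c) \<le> ?c * hausdorff_premeasure s \<delta> A"
    by (intro mult_left_mono) auto
  then show ?thesis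
    using c ennreal_mult_divide_eq[of ?c "hausdorff_premeasure s (c * \<delta>) (f ` A)"]
    by (simp add: ennreal_times_divide mult.commute)
qed

section \<open>Null sets and dimension\<close>

lemma hausdorff_measure_eq_0_iff:
  "hausdorff_measure s A = 0 \<longleftrightarrow> (\<forall>\<delta>>0. hausdorff_premeasure s \<delta> A = 0)"
  unfolding hausdorff_measure_def bot_ennreal[symmetric] SUP_bot_conv by auto

lemma hausdorff_null_subset:
  "hausdorff_measure s B = 0 \<Longrightarrow> A \<subseteq> B \<Longrightarrow> hausdorff_measure s A = 0"
  unfolding hausdorff_measure_eq_0_iff using hausdorff_premeasure_mono[of A B s]
  by (metis le_zero_eq)

lemma hausdorff_null_UN:
  fixes A :: "nat \<Rightarrow> 'a::metric_space set"
  assumes "\<And>i. hausdorff_measure s (A i) = 0"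
  shows "hausdorff_measure s (\<Union>i. A i) = 0"
  unfolding hausdorff_measure_eq_0_iff
proof (intro allI impI)
  fix \<delta> :: real assume "0 < \<delta>"
  then show "hausdorff_premeasure s \<delta> (\<Union>i. A i) = 0"
    using assms hausdorff_premeasure_UN_le[of s \<delta> A] by (simp add: hausdorff_measure_eq_0_iff)
qed

lemma hausdorff_null_lipschitz_image:
  fixes f :: "'a::metric_space \<Rightarrow> 'b::metric_space"
  assumes "hausdorff_measure s A = 0" "0 < s" "0 < c"
    "\<And>x y. x \<in> A \<Longrightarrow> y \<in> A \<Longrightarrow> dist (f x) (f y) \<le> c * dist x y"
  shows "hausdorff_measure s (f ` A) = 0"
  unfolding hausdorff_measure_eq_0_iff
proof (intro allI impI)
  fix \<delta> :: real assume "0 < \<delta>"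
  then have "hausdorff_premeasure s (\<delta> / c) A = 0"
    using assms(1,3) by (simp add: hausdorff_measure_eq_0_iff)
  then show "hausdorff_premeasure s \<delta> (f ` A) = 0"
    using hausdorff_premeasure_image_le[of s c A f "\<delta> / c"] assms(2-4) by simp
qed

lemma hausdorff_dim_le:
  assumes "\<And>t. s < t \<Longrightarrow> hausdorff_measure t A = 0" "0 \<le> s"
  shows "hausdorff_dim A \<le> ereal s"
proof (rule ereal_le_epsilon2)
  fix e :: real assume "0 < e"
  then show "hausdorff_dim A \<le> ereal s + ereal e"
    unfolding hausdorff_dim_def using assms by (intro Inf_lower) (auto intro!: exI[of _ "s + e"])
qed

lemma hausdorff_dim_ge:
  assumes "\<And>t. 0 \<le> t \<Longrightarrow> t < s \<Longrightarrow> hausdorff_measure t A \<noteq> 0"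
  shows "ereal s \<le> hausdorff_dim A"
  unfolding hausdorff_dim_def by (rule Inf_greatest) (use assms in force)

lemma hausdorff_dim_mono: "A \<subseteq> B \<Longrightarrow> hausdorff_dim A \<le> hausdorff_dim B"
  unfolding hausdorff_dim_def by (rule Inf_superset_mono) (use hausdorff_null_subset in blast)

text \<open>Replaces the mass distribution principle: the measure on \<open>A\<close> would be the push-forward
  of Lebesgue measure under \<open>\<Phi>\<close>.\<close>

lemma hausdorff_measure_pos_if_param:
  fixes \<Phi> :: "real \<Rightarrow> 'a::metric_space"
  assumes "0 \<le> s" "0 < C" and A: "\<And>y. y \<in> {0..<1} \<Longrightarrow> \<Phi> y \<in> A"
    and \<Phi>: "\<And>y z. y \<in> {0..<1} \<Longrightarrow> z \<in> {0..<1} \<Longrightarrow> y \<noteq> z \<Longrightarrow> \<bar>y - z\<bar> \<le> C * dist (\<Phi> y) (\<Phi> z) powr s"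
  shows "hausdorff_measure s A \<noteq> 0"
proof
  assume "hausdorff_measure s A = 0"
  then have "hausdorff_premeasure s 1 A = 0" by (simp add: hausdorff_measure_eq_0_iff)
  \<comment> \<open>The bound \<open>1 / (4 * C)\<close> makes the total length of the intervals
    built below at most 1/2, less than the length of \<open>{0..<1}\<close>.\<close>
  then have "(INF U\<in>delta_covers 1 A. \<Sum>i. diam_power s (U i)) < ennreal (1 / (4 * C))"
    using \<open>0 < C\<close> by (simp add: hausdorff_premeasure_def)
  then obtain U where U: "U \<in> delta_covers 1 A"
    and small: "(\<Sum>i. diam_power s (U i)) < ennreal (1 / (4 * C))"
    unfolding INF_less_iff by blast
  \<comment> \<open>The parameters mapped into \<open>U i\<close> may form a nonmeasurable set, so
    they are enclosed in an interval centred at one of them.\<close>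
  have "\<exists>V\<in>sets lborel. {y \<in> {0..<1}. \<Phi> y \<in> U i} \<subseteq> V \<and> emeasure lborel V \<le> ennreal (2 * C) * diam_power s (U i)" for i
  proof (cases "{y \<in> {0..<1}. \<Phi> y \<in> U i} = {}")
    case True
    then show ?thesis by (intro bexI[of _ "{}"]) auto
  next
    case False
    then obtain a where a: "a \<in> {0..<1}" "\<Phi> a \<in> U i" by auto
    have b: "bounded (U i)" using U by (auto simp: delta_covers_def)
    \<comment> \<open>The real value of \<open>diam_power\<close>; it is 1 at exponent 0, although
      \<open>0 powr 0 = 0\<close>.\<close>
    define D where "D = (if s = 0 then 1 else diameter (U i) powr s)"
    have D: "0 \<le> D" "diam_power s (U i) = ennreal D" using a by (auto simp: D_def diam_power_def)
    have "\<bar>a - y\<bar> \<le> C * D" if "y \<in> {0..<1}" "\<Phi> y \<in> U i" for y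
    proof (cases "a = y")
      case True then show ?thesis using D \<open>0 < C\<close> by simp
    next
      case False
      have "\<bar>a - y\<bar> \<le> C * dist (\<Phi> a) (\<Phi> y) powr s" using \<Phi> a that False by blast
      also have "dist (\<Phi> a) (\<Phi> y) powr s \<le> D"
        using diameter_bounded_bound[OF b a(2) that(2)] \<open>0 \<le> s\<close>
        by (auto simp: D_def intro!: powr_mono2)
      finally show ?thesis using \<open>0 < C\<close> by simp
    qed
    then have "{y \<in> {0..<1}. \<Phi> y \<in> U i} \<subseteq> {a - C * D .. a + C * D}" by (force simp: abs_le_iff)
    moreover have "emeasure lborel {a - C * D .. a + C * D} = ennreal (2 * C) * diam_power s (U i)"
      using D \<open>0 < C\<close> by (simp add: ennreal_mult[symmetric])
    ultimately show ?thesis by (intro bexI[of _ "{a - C * D .. a + C * D}"]) auto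
  qed
  then obtain V where V: "\<And>i. V i \<in> sets lborel" "\<And>i. {y \<in> {0..<1}. \<Phi> y \<in> U i} \<subseteq> V i"
    "\<And>i. emeasure lborel (V i) \<le> ennreal (2 * C) * diam_power s (U i)"
    by metis
  have "{0..<1} \<subseteq> (\<Union>i. V i)"
  proof
    fix y :: real assume y: "y \<in> {0..<1}"
    then obtain i where "\<Phi> y \<in> U i" using U A by (fastforce simp: delta_covers_def)
    then show "y \<in> (\<Union>i. V i)" using V(2)[of i] y by blast
  qed
  then have "emeasure lborel {0..<1::real} \<le> emeasure lborel (\<Union>i. V i)"
    using V(1) by (intro emeasure_mono) auto
  also have "\<dots> \<le> (\<Sum>i. emeasure lborel (V i))"
    using V(1) by (intro emeasure_subadditive_countably) auto
  also have "\<dots> \<le> (\<Sum>i. ennreal (2 * C) * diam_power s (U i))"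
    by (intro suminf_le V(3)) auto
  also have "\<dots> = ennreal (2 * C) * (\<Sum>i. diam_power s (U i))" by simp
  also have "\<dots> \<le> ennreal (2 * C) * ennreal (1 / (4 * C))"
    using small by (intro mult_left_mono) auto
  also have "\<dots> = ennreal (1 / 2)"
    using \<open>0 < C\<close> by (simp add: ennreal_mult[symmetric] del: ennreal_1)
  finally have "ennreal 1 \<le> ennreal (1 / 2)" by simp
  then show False by (subst (asm) ennreal_le_iff) auto
qed

subsection \<open>The transfer operator estimate\<close>

text \<open>The ratio of the inverse branch that ends in \<open>W lam n\<close>. Index 0 shares the
  value of the levels from 2 on, so the bounds below hold for every \<open>n\<close>.\<close>

definition contraction :: "real \<Rightarrow> nat \<Rightarrow> real" where
  "contraction lam n = (if n = 1 then 1 - lam else lam * (1 - lam))"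

lemma contraction_bounds:
  assumes "0 < lam" "lam < 1"
  shows "0 < contraction lam n" "contraction lam n \<le> 1 - lam"
  using assms mult_right_mono[of lam 1 "1 - lam"] by (auto simp: contraction_def)

section \<open>Inverse branches and transitions between levels\<close>

lemma F_eq_contraction:
  assumes "0 < lam" "lam < 1" "1 \<le> n" "x \<in> W lam n"
  shows "F lam x = (x - lam ^ n) / contraction lam n"
proof (cases "n = 1")
  case True
  then show ?thesis using assms F_W1[of x lam] by (simp add: contraction_def)
next
  case False
  then show ?thesis using assms F_Wn[of lam n x] by (simp add: contraction_def)
qed

lemma F_inverse_branch:
  assumes "0 < lam" "lam < 1" "1 \<le> n" "x \<in> W lam n"
  shows "x = lam ^ n + contraction lam n * F lam x"
  using F_eq_contraction[OF assms] contraction_bounds(1)[OF assms(1,2), of n] by simp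

text \<open>The Markov property: the lowest level that can follow \<open>n\<close> is
  \<open>max 1 (n - 1)\<close>, and the bound is the right endpoint of that level.\<close>

lemma F_W_subset:
  assumes "0 < lam" "lam < 1" "1 \<le> n" "x \<in> W lam n"
  shows "F lam x \<in> {0<..lam ^ (max 1 (n - 1) - 1)}"
proof -
  have "lam ^ (n - 1) - lam ^ n = contraction lam n * lam ^ (max 1 (n - 1) - 1)"
  proof (cases "n = 1")
    case False
    then obtain k where "n = Suc (Suc k)" using \<open>1 \<le> n\<close> by (metis Suc_le_D One_nat_def not0_implies_Suc)
    then show ?thesis by (simp add: contraction_def algebra_simps)
  qed (simp add: contraction_def)
  moreover have "lam ^ n < x" "x \<le> lam ^ (n - 1)" using assms(4) by (auto simp: W_def)
  ultimately show ?thesis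
    unfolding F_eq_contraction[OF assms] using contraction_bounds(1)[OF assms(1,2), of n]
    by (auto simp: pos_divide_le_eq mult.commute)
qed

lemma W_obtain:
  assumes "0 < lam" "lam < 1" "x \<in> {0<..1}"
  obtains n where "1 \<le> n" "x \<in> W lam n"
proof -
  have "x \<in> (\<Union>n\<in>{1..}. W lam n)" using W_cover[OF assms(1,2)] assms(3) by simp
  then show ?thesis using that by auto
qed

lemma W_obtain_ge:
  assumes "0 < lam" "lam < 1" "1 \<le> m" "x \<in> {0<..lam ^ (m - 1)}"
  obtains i where "x \<in> W lam (m + i)"
proof -
  have "lam ^ (m - 1) \<le> 1" using assms by (simp add: power_le_one)
  then have "x \<in> {0<..1}" using assms(4) by simp
  then obtain n where n: "1 \<le> n" "x \<in> W lam n"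
    using W_obtain[OF assms(1,2)] by blast
  have "m \<le> n"
  proof (rule ccontr)
    assume "\<not> m \<le> n"
    then have "lam ^ (m - 1) \<le> lam ^ n" using assms by (intro power_decreasing) auto
    moreover have "lam ^ n < x" "x \<le> lam ^ (m - 1)" using n assms(4) by (auto simp: W_def)
    ultimately show False by linarith
  qed
  then show ?thesis using that[of "n - m"] n by simp
qed

lemma F_maps_unit:
  assumes "0 < lam" "lam < 1" "x \<in> {0<..1}"
  shows "F lam x \<in> {0<..1}"
proof -
  obtain n where n: "1 \<le> n" "x \<in> W lam n" using W_obtain[OF assms] .
  have "lam ^ (max 1 (n - 1) - 1) \<le> 1" using assms by (simp add: power_le_one)
  then show ?thesis using F_W_subset[OF assms(1,2) n] by auto
qed

lemma F_funpow_maps_unit: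
  assumes "0 < lam" "lam < 1" "x \<in> {0<..1}"
  shows "(F lam ^^ k) x \<in> {0<..1}"
proof (induction k)
  case (Suc k)
  then show ?case using F_maps_unit[OF assms(1,2)] by simp
qed (use assms in simp)

text \<open>The preimage lies in countably many affine images of \<open>A\<close>, one for each
  inverse branch.\<close>

lemma hausdorff_null_F_preimage:
  assumes "0 < lam" "lam < 1" "0 < s" and A: "hausdorff_measure s A = 0"
  shows "hausdorff_measure s {x \<in> {0<..1}. F lam x \<in> A} = 0"
proof (rule hausdorff_null_subset)
  let ?g = "\<lambda>n y. lam ^ n + contraction lam n * y"
  show "hausdorff_measure s (\<Union>n. ?g n ` A) = 0"
  proof (rule hausdorff_null_UN)
    fix n
    show "hausdorff_measure s (?g n ` A) = 0"
      using contraction_bounds(1)[OF assms(1,2), of n]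
      by (intro hausdorff_null_lipschitz_image[OF A assms(3), of "contraction lam n"])
         (auto simp: dist_real_def abs_mult simp flip: right_diff_distrib)
  qed
  show "{x \<in> {0<..1}. F lam x \<in> A} \<subseteq> (\<Union>n. ?g n ` A)"
  proof
    fix x assume x: "x \<in> {x \<in> {0<..1}. F lam x \<in> A}"
    then have "x \<in> {0<..1}" by blast
    then obtain n where "1 \<le> n" "x \<in> W lam n" using W_obtain[OF assms(1,2)] by metis
    then have "x = ?g n (F lam x)" using F_inverse_branch[OF assms(1,2)] by blast
    then show "x \<in> (\<Union>n. ?g n ` A)" using x by blast
  qed
qed

lemma suminf_geometric_half:
  assumes "0 \<le> K"
  shows "(\<Sum>i. ennreal (K * (1/2) ^ (m + i))) = ennreal (2 * K * (1/2) ^ m)"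
proof -
  have "(\<lambda>i. (K * (1/2) ^ m) * (1/2) ^ i) sums ((K * (1/2) ^ m) * (1 / (1 - 1/2)))"
    by (intro sums_mult geometric_sums) auto
  then have "(\<lambda>i. K * (1/2) ^ (m + i)) sums (2 * K * (1/2) ^ m)"
    by (simp add: power_add mult_ac)
  then show ?thesis using assms by (intro suminf_ennreal_eq) auto
qed

text \<open>The weights \<open>(1/2) ^ n\<close> form a supersolution of the transfer operator. Their base is optimal:
  a level \<open>n \<ge> 2\<close> is followed by the levels \<open>n - 1 + j\<close> with \<open>j \<ge> 0\<close>, and
  \<open>(\<Sum>j. z ^ (n - 1 + j)) / z ^ n = 1 / (z * (1 - z))\<close> has its minimum \<open>4\<close> at \<open>z = 1/2\<close>.\<close>

lemma hausdorff_null_invariant: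
  assumes lam: "0 < lam" "lam < 1" and "0 < s"
    and E: "E \<subseteq> {0<..1}" "\<And>x. x \<in> E \<Longrightarrow> F lam x \<in> E"
    and \<rho>: "4 * (lam * (1 - lam)) powr s \<le> \<rho>" "\<rho> < 1"
      "E \<inter> W lam 1 = {} \<or> 2 * (1 - lam) powr s \<le> \<rho>"
    and C: "\<And>n. 1 \<le> n \<Longrightarrow> E \<inter> W lam n = {} \<or> (lam ^ (n - 1)) powr s \<le> C * (1/2) ^ n"
  shows "hausdorff_measure s E = 0"
proof -
  let ?P = "hausdorff_premeasure s"
  let ?K = "max C 0"
  have \<rho>0: "0 \<le> \<rho>" using \<rho>(1) by (meson order_trans powr_ge_zero zero_le_mult_iff zero_le_numeral)
  \<comment> \<open>Each induction step pulls covers of the successor levels back through one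
    inverse branch; this shrinks the scale by at least \<open>1 - lam\<close> and gains a factor
    \<rho>.\<close>
  have step: "?P ((1 - lam) ^ k) (E \<inter> W lam n) \<le> ennreal (?K * \<rho> ^ k * (1/2) ^ n)" if "1 \<le> n" for k n
    using that
  proof (induction k arbitrary: n)
    case 0
    show ?case
    proof (cases "E \<inter> W lam n = {}")
      case True
      then show ?thesis by (simp add: hausdorff_premeasure_empty)
    next
      case False
      have diam: "diameter (E \<inter> W lam n) \<le> lam ^ (n - 1)"
      proof (rule diameter_le)
        fix x y assume "x \<in> E \<inter> W lam n" "y \<in> E \<inter> W lam n"
        then have "0 < x" "0 < y" "x \<le> lam ^ (n - 1)" "y \<le> lam ^ (n - 1)"
          using E(1) by (auto simp: W_def)
        then show "norm (x - y) \<le> lam ^ (n - 1)" by auto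
      qed (use False in auto)
      have bdd: "bounded (E \<inter> W lam n)" by (rule bounded_subset[of "{0..1}"]) (use E in auto)
      have "lam ^ (n - 1) \<le> 1" using lam by (simp add: power_le_one)
      then have "?P 1 (E \<inter> W lam n) \<le> diam_power s (E \<inter> W lam n)"
        using diam bdd by (intro hausdorff_premeasure_le_diam_power) auto
      also have "\<dots> \<le> ennreal ((lam ^ (n - 1)) powr s)"
        using diam bdd \<open>0 < s\<close> diameter_ge_0[OF bdd]
        by (simp add: diam_power_pos ennreal_leI powr_mono2)
      also have "\<dots> \<le> ennreal (?K * (1/2) ^ n)"
      proof (rule ennreal_leI)
        have "(lam ^ (n - 1)) powr s \<le> C * (1/2) ^ n" using C[OF 0] False by blast
        also have "\<dots> \<le> ?K * (1/2) ^ n" by (intro mult_right_mono) auto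
        finally show "(lam ^ (n - 1)) powr s \<le> ?K * (1/2) ^ n" .
      qed
      finally show ?thesis by simp
    qed
  next
    case (Suc k)
    let ?c = "contraction lam n"
    let ?m = "max 1 (n - 1)"
    have c: "0 < ?c" "?c \<le> 1 - lam" using contraction_bounds[OF lam] by auto
    show ?case
    proof (cases "E \<inter> W lam n = {}")
      case True
      then show ?thesis using lam by (simp add: hausdorff_premeasure_empty)
    next
      case False
      let ?A = "\<lambda>i. E \<inter> W lam (?m + i)"
      have sub: "E \<inter> W lam n \<subseteq> (\<lambda>y. lam ^ n + ?c * y) ` (\<Union>i. ?A i)"
      proof
        fix x assume x: "x \<in> E \<inter> W lam n"
        then have "F lam x \<in> {0<..lam ^ (?m - 1)}" using F_W_subset[OF lam Suc.prems] by blast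
        then obtain i where "F lam x \<in> W lam (?m + i)"
          using W_obtain_ge[OF lam, of ?m] by auto
        moreover have "x = lam ^ n + ?c * F lam x" using F_inverse_branch[OF lam Suc.prems] x by blast
        ultimately show "x \<in> (\<lambda>y. lam ^ n + ?c * y) ` (\<Union>i. ?A i)" using E(2) x by blast
      qed
      \<comment> \<open>\<open>2 * (1/2) ^ ?m\<close> is the total weight of the levels that can
        follow \<open>n\<close>. At level 1 the claim is the second alternative of the level 1
        hypothesis on \<rho>; from level 2 on it follows from
        \<open>2 * (1/2) ^ (n - 1) = 4 * (1/2) ^ n\<close>.\<close>
      have weight: "?c powr s * 2 * (1/2) ^ ?m \<le> \<rho> * (1/2) ^ n"
      proof (cases "n = 1")
        case True
        then show ?thesis using \<rho>(3) False by (simp add: contraction_def)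
      next
        case n: False
        then obtain j where "n = Suc (Suc j)"
          using Suc.prems by (metis Suc_le_D One_nat_def not0_implies_Suc)
        then show ?thesis using \<rho>(1) by (simp add: contraction_def field_simps)
      qed
      have "?P ((1 - lam) ^ Suc k) (E \<inter> W lam n) \<le> ?P (?c * (1 - lam) ^ k) (E \<inter> W lam n)"
        using c lam by (intro hausdorff_premeasure_antimono) (simp add: mult_right_mono)
      also have "\<dots> \<le> ?P (?c * (1 - lam) ^ k) ((\<lambda>y. lam ^ n + ?c * y) ` (\<Union>i. ?A i))"
        by (rule hausdorff_premeasure_mono[OF sub])
      also have "\<dots> \<le> ennreal (?c powr s) * ?P ((1 - lam) ^ k) (\<Union>i. ?A i)"
        using c \<open>0 < s\<close> by (intro hausdorff_premeasure_image_le)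
         (auto simp: dist_real_def abs_mult simp flip: right_diff_distrib)
      also have "\<dots> \<le> ennreal (?c powr s) * (\<Sum>i. ?P ((1 - lam) ^ k) (?A i))"
        by (intro mult_left_mono hausdorff_premeasure_UN_le) auto
      also have "\<dots> \<le> ennreal (?c powr s) * (\<Sum>i. ennreal (?K * \<rho> ^ k * (1/2) ^ (?m + i)))"
        by (intro mult_left_mono suminf_le Suc.IH) auto
      also have "\<dots> = ennreal (?c powr s) * ennreal (2 * (?K * \<rho> ^ k) * (1/2) ^ ?m)"
        using \<rho>0 by (subst suminf_geometric_half) auto
      also have "\<dots> = ennreal (?K * \<rho> ^ k * (?c powr s * 2 * (1/2) ^ ?m))"
        using \<rho>0 by (simp add: ennreal_mult[symmetric] mult_ac)
      also have "\<dots> \<le> ennreal (?K * \<rho> ^ k * (\<rho> * (1/2) ^ n))"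
        using \<rho>0 by (intro ennreal_leI mult_left_mono weight) auto
      finally show ?thesis by (simp add: mult_ac)
    qed
  qed
  have null: "hausdorff_measure s (E \<inter> W lam n) = 0" if n: "1 \<le> n" for n
    unfolding hausdorff_measure_eq_0_iff
  proof (intro allI impI)
    fix \<delta> :: real assume "0 < \<delta>"
    \<comment> \<open>As \<open>k\<close> grows, the scale falls below \<delta> while the bound
      \<open>?K * \<rho> ^ k * (1/2) ^ n\<close> tends to 0.\<close>
    have "(\<lambda>k. (1 - lam) ^ k) \<longlonglongrightarrow> 0" using lam by (intro LIMSEQ_power_zero) auto
    then have "\<forall>\<^sub>F k in sequentially. (1 - lam) ^ k < \<delta>"
      using \<open>0 < \<delta>\<close> by (rule order_tendstoD)
    then have ev: "\<forall>\<^sub>F k in sequentially. ?P \<delta> (E \<inter> W lam n) \<le> ennreal (?K * \<rho> ^ k * (1/2) ^ n)"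
    proof eventually_elim
      case (elim k)
      then show ?case
        using step[OF n, of k] hausdorff_premeasure_antimono[of "(1 - lam) ^ k" \<delta> s "E \<inter> W lam n"]
        by (meson less_imp_le order_trans)
    qed
    have "(\<lambda>k. ?K * \<rho> ^ k * (1/2) ^ n) \<longlonglongrightarrow> ?K * 0 * (1/2) ^ n"
      using \<rho>0 \<rho>(2) by (intro tendsto_intros LIMSEQ_power_zero) auto
    then have "(\<lambda>k. ennreal (?K * \<rho> ^ k * (1/2) ^ n)) \<longlonglongrightarrow> ennreal 0"
      by (intro tendsto_ennrealI) simp
    then have "?P \<delta> (E \<inter> W lam n) \<le> ennreal 0"
      using ev by (rule tendsto_lowerbound) simp
    then show "?P \<delta> (E \<inter> W lam n) = 0" by simp
  qed
  show ?thesis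
  proof (rule hausdorff_null_subset)
    show "hausdorff_measure s (\<Union>n. E \<inter> W lam (Suc n)) = 0"
      by (intro hausdorff_null_UN null) simp
    show "E \<subseteq> (\<Union>n. E \<inter> W lam (Suc n))"
    proof
      fix x assume x: "x \<in> E"
      then obtain n where "1 \<le> n" "x \<in> W lam n" using W_obtain[OF lam] E(1) by blast
      then show "x \<in> (\<Union>n. E \<inter> W lam (Suc n))" using x by (auto intro!: exI[of _ "n - 1"])
    qed
  qed
qed

text \<open>The estimate above is applied with \<open>lam = 1/2\<close> to the whole interval, which
  is invariant.\<close>

lemma hausdorff_dim_unit_interval_le: "hausdorff_dim {0<..1::real} \<le> 1"
proof -
  have "hausdorff_measure t {0<..1::real} = 0" if t: "1 < t" for t :: real
  proof (rule hausdorff_null_invariant[where lam = "1/2" and \<rho> = "2 * (1/2) powr t" and C = 2])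
    have "(1/2) powr t < (1/2 :: real) powr 1" using t by (intro powr_less_mono') auto
    then have half: "2 * (1/2) powr t < (1::real)" by simp
    show "2 * (1/2) powr t < (1::real)" by (rule half)
    \<comment> \<open>\<open>4 * (1/4) powr t\<close> is the square of
      \<open>2 * (1/2) powr t\<close>, hence at most that number, which is below 1.\<close>
    have "(1/2 * (1 - 1/2)) powr t = (1/2) powr t * (1/2 :: real) powr t"
      by (simp flip: powr_mult)
    then show "4 * (1/2 * (1 - 1/2)) powr t \<le> 2 * (1/2 :: real) powr t"
      using mult_right_mono[of "2 * (1/2) powr t" 1 "2 * (1/2 :: real) powr t"] half by simp
    fix n :: nat assume n: "1 \<le> n"
    have "((1/2) ^ (n - 1)) powr t \<le> ((1/2 :: real) ^ (n - 1)) powr 1"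
      using t by (intro powr_mono') (auto intro: power_le_one)
    also have "\<dots> = 2 * (1/2) ^ n" using n by (cases n) auto
    finally show "{0<..1} \<inter> W (1/2) n = {} \<or> ((1/2) ^ (n - 1)) powr t \<le> 2 * (1/2 :: real) ^ n" by simp
  qed (use t F_maps_unit[of "1/2"] in auto)
  then have "hausdorff_dim {0<..1::real} \<le> ereal 1" by (intro hausdorff_dim_le) auto
  then show ?thesis by (simp add: one_ereal_def)
qed

subsection \<open>Upper bounds and compactness\<close>

lemma power_powr:
  fixes x :: real
  shows "0 < x \<Longrightarrow> (x ^ n) powr t = (x powr t) ^ n"
  by (induction n) (simp_all add: powr_mult)

text \<open>The exponent at which the optimal growth factor 4 of the level weights balances the
  contraction: the solution \<open>s\<close> of
  \<open>4 * (lam * (1 - lam)) powr s = 1\<close>.\<close>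

definition crit_exp :: "real \<Rightarrow> real" where
  "crit_exp lam = - (ln 4 / ln (lam * (1 - lam)))"

text \<open>Links the hyperbolic dimension at \<open>1 - lam\<close> with the escaping set at
  \<open>lam\<close>.\<close>

lemma crit_exp_sym: "crit_exp (1 - lam) = crit_exp lam"
  by (simp add: crit_exp_def mult.commute)

context
  fixes lam :: real
  assumes lam: "0 < lam" "lam < 1"
begin

lemma branch_ratio: "0 < lam * (1 - lam)" "lam * (1 - lam) < 1"
  using lam mult_strict_mono[of lam 1 "1 - lam" 1] by auto

lemma crit_exp_pos: "0 < crit_exp lam"
proof -
  have "ln 4 / ln (lam * (1 - lam)) < 0"
    by (intro divide_pos_neg ln_less_zero branch_ratio) simp
  then show ?thesis unfolding crit_exp_def by linarith
qed

lemma branch_ratio_powr_crit_exp: "(lam * (1 - lam)) powr crit_exp lam = 1 / 4"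
proof -
  have "ln (lam * (1 - lam)) \<noteq> 0" using ln_less_zero[OF branch_ratio] by simp
  then have "crit_exp lam * ln (lam * (1 - lam)) = - ln 4"
    unfolding crit_exp_def minus_divide_left by (rule nonzero_eq_divide_eq[THEN iffD1, OF _ refl])
  then have "(lam * (1 - lam)) powr crit_exp lam = exp (- ln 4)"
    using branch_ratio unfolding powr_def by (simp only: if_False less_imp_neq[symmetric])
  then show ?thesis by (simp add: exp_minus)
qed

lemma powr_crit_exp_prod: "lam powr crit_exp lam * (1 - lam) powr crit_exp lam = 1 / 4"
  using branch_ratio_powr_crit_exp by (simp add: powr_mult)

text \<open>For \<open>lam \<le> 1/2\<close> this is the smaller of two factors with product
  1/4.\<close>

lemma powr_crit_exp_le:
  assumes "lam \<le> 1/2"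
  shows "lam powr crit_exp lam \<le> 1 / 2"
proof -
  have "lam powr crit_exp lam \<le> (1 - lam) powr crit_exp lam"
    using assms lam crit_exp_pos by (intro powr_mono2) auto
  then have "lam powr crit_exp lam * lam powr crit_exp lam \<le> lam powr crit_exp lam * (1 - lam) powr crit_exp lam"
    by (intro mult_left_mono) auto
  then have "(lam powr crit_exp lam)\<^sup>2 \<le> (1/2)\<^sup>2"
    using powr_crit_exp_prod by (simp add: power2_eq_square)
  then show ?thesis by (rule power2_le_imp_le) simp
qed

lemma four_branch_ratio_powr_less:
  assumes "crit_exp lam < t"
  shows "4 * (lam * (1 - lam)) powr t < 1"
  using powr_less_mono'[OF branch_ratio assms] branch_ratio_powr_crit_exp by simp

lemma hausdorff_null_F_funpow_preimage:
  assumes "0 < s" "hausdorff_measure s E = 0"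
  shows "hausdorff_measure s {x \<in> {0<..1}. (F lam ^^ k) x \<in> E} = 0"
proof (induction k)
  case 0
  then show ?case using assms by (auto intro: hausdorff_null_subset)
next
  case (Suc k)
  have "{x \<in> {0<..1}. (F lam ^^ Suc k) x \<in> E}
    \<subseteq> {x \<in> {0<..1}. F lam x \<in> {y \<in> {0<..1}. (F lam ^^ k) y \<in> E}}"
    using F_maps_unit[OF lam] by (auto simp: funpow_swap1)
  then show ?case
    using hausdorff_null_F_preimage[OF lam assms(1) Suc.IH] by (rule hausdorff_null_subset[rotated])
qed

text \<open>An escaping orbit eventually stays off level 1. The set \<open>E\<close> of points whose
  whole orbit avoids level 1 is forward invariant and null, and the escaping set lies in the union
  of its preimages under the iterates.\<close>

lemma escaping_dim_le_crit_exp: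
  assumes "lam \<le> 1/2"
  shows "hausdorff_dim (escaping_set lam) \<le> ereal (crit_exp lam)"
proof (rule hausdorff_dim_le)
  fix t assume t: "crit_exp lam < t"
  define E where "E = {x \<in> {0<..1}. \<forall>k. (F lam ^^ k) x \<le> lam}"
  have "0 < t" using t crit_exp_pos by simp
  have "hausdorff_measure t E = 0"
  proof (rule hausdorff_null_invariant[OF lam \<open>0 < t\<close>])
    show "4 * (lam * (1 - lam)) powr t \<le> 4 * (lam * (1 - lam)) powr t" by simp
    show "4 * (lam * (1 - lam)) powr t < 1" by (rule four_branch_ratio_powr_less[OF t])
    have "(F lam ^^ 0) x \<le> lam" if "x \<in> E" for x using that unfolding E_def by blast
    then show "E \<inter> W lam 1 = {} \<or> 2 * (1 - lam) powr t \<le> 4 * (lam * (1 - lam)) powr t"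
      by (fastforce simp: W_def)
    show "F lam x \<in> E" if "x \<in> E" for x
    proof -
      have "(F lam ^^ k) (F lam x) \<le> lam" for k
      proof -
        have "(F lam ^^ Suc k) x \<le> lam" using that unfolding E_def by blast
        then show ?thesis by (simp add: funpow_swap1)
      qed
      moreover have "F lam x \<in> {0<..1}" using that F_maps_unit[OF lam] by (simp add: E_def)
      ultimately show ?thesis by (simp add: E_def)
    qed
    fix n :: nat assume n: "1 \<le> n"
    \<comment> \<open>Here \<open>lam \<le> 1/2\<close> enters: the diameters of the levels, raised
      to the power \<open>t\<close>, decay at least as fast as the weights
      \<open>(1/2) ^ n\<close>.\<close>
    have "lam powr t \<le> lam powr crit_exp lam" using lam t by (intro powr_mono') auto
    then have half: "lam powr t \<le> 1 / 2" using powr_crit_exp_le[OF assms] by simp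
    have "(lam ^ (n - 1)) powr t = (lam powr t) ^ (n - 1)" using lam by (simp add: power_powr)
    also have "\<dots> \<le> (1/2) ^ (n - 1)" using half by (intro power_mono) auto
    also have "\<dots> = 2 * (1/2) ^ n" using n by (cases n) auto
    finally show "E \<inter> W lam n = {} \<or> (lam ^ (n - 1)) powr t \<le> 2 * (1/2) ^ n" by simp
  qed (auto simp: E_def)
  then have "hausdorff_measure t (\<Union>k. {x \<in> {0<..1}. (F lam ^^ k) x \<in> E}) = 0"
    using \<open>0 < t\<close> by (intro hausdorff_null_UN hausdorff_null_F_funpow_preimage)
  moreover have "escaping_set lam \<subseteq> (\<Union>k. {x \<in> {0<..1}. (F lam ^^ k) x \<in> E})"
  proof
    fix x assume "x \<in> escaping_set lam"
    then have x: "x \<in> {0<..1}" "(\<lambda>n. (F lam ^^ n) x) \<longlonglongrightarrow> 0" by (auto simp: escaping_set_def)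
    then have "\<forall>\<^sub>F n in sequentially. (F lam ^^ n) x < lam" using lam by (intro order_tendstoD)
    then obtain k where k: "\<And>n. k \<le> n \<Longrightarrow> (F lam ^^ n) x < lam" by (auto simp: eventually_sequentially)
    have "(F lam ^^ i) ((F lam ^^ k) x) \<le> lam" for i
      using k[of "i + k"] by (simp add: funpow_add)
    then have "(F lam ^^ k) x \<in> E"
      using F_funpow_maps_unit[OF lam x(1)] by (simp add: E_def)
    then show "x \<in> (\<Union>k. {x \<in> {0<..1}. (F lam ^^ k) x \<in> E})" using x by blast
  qed
  ultimately show "hausdorff_measure t (escaping_set lam) = 0" by (rule hausdorff_null_subset)
qed (use crit_exp_pos in simp)

text \<open>A compact set avoiding 0 meets only levels up to some \<open>N\<close>, so the constant
  \<open>2 ^ N\<close> makes the initial bound hold. The condition \<open>1/2 \<le> lam\<close>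
  controls level 1: it gives \<open>(1 - lam) powr t < 1/2\<close> above the critical
  exponent.\<close>

lemma hyperbolic_dim_le_crit_exp:
  assumes "1/2 \<le> lam"
  shows "hyperbolic_dim (F lam) \<le> ereal (crit_exp lam)"
  unfolding hyperbolic_dim_def
proof (rule Sup_least, clarify)
  fix \<Lambda> assume \<Lambda>: "compact \<Lambda>" "\<Lambda> \<subseteq> {0<..1}" "F lam ` \<Lambda> \<subseteq> \<Lambda>"
  have "\<exists>\<epsilon>>0. \<forall>x\<in>\<Lambda>. \<epsilon> \<le> x"
  proof (cases "\<Lambda> = {}")
    case False
    then obtain x where "x \<in> \<Lambda>" "\<And>y. y \<in> \<Lambda> \<Longrightarrow> x \<le> y"
      using compact_attains_inf[OF \<Lambda>(1)] by blast
    moreover from this have "0 < x" using \<Lambda>(2) by auto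
    ultimately show ?thesis by blast
  qed (auto intro: exI[of _ 1])
  then obtain \<epsilon> where \<epsilon>: "0 < \<epsilon>" "\<And>x. x \<in> \<Lambda> \<Longrightarrow> \<epsilon> \<le> x" by blast
  obtain N where N: "lam ^ N < \<epsilon>" using real_arch_pow_inv[OF \<epsilon>(1) lam(2)] by blast
  show "hausdorff_dim \<Lambda> \<le> ereal (crit_exp lam)"
  proof (rule hausdorff_dim_le)
    fix t assume t: "crit_exp lam < t"
    then have "0 < t" using crit_exp_pos by simp
    have "(1 - lam) powr crit_exp lam \<le> lam powr crit_exp lam"
      using assms lam crit_exp_pos by (intro powr_mono2) auto
    then have "(1 - lam) powr crit_exp lam * (1 - lam) powr crit_exp lam \<le> lam powr crit_exp lam * (1 - lam) powr crit_exp lam"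
      by (intro mult_right_mono) auto
    then have "((1 - lam) powr crit_exp lam)\<^sup>2 \<le> (1/2)\<^sup>2"
      using powr_crit_exp_prod by (simp add: power2_eq_square)
    then have "(1 - lam) powr crit_exp lam \<le> 1 / 2" by (rule power2_le_imp_le) simp
    moreover have "(1 - lam) powr t < (1 - lam) powr crit_exp lam"
      using lam t by (intro powr_less_mono') auto
    ultimately have half: "2 * (1 - lam) powr t < 1" by simp
    show "hausdorff_measure t \<Lambda> = 0"
    proof (rule hausdorff_null_invariant[OF lam \<open>0 < t\<close> \<Lambda>(2)])
      let ?\<rho> = "max (4 * (lam * (1 - lam)) powr t) (2 * (1 - lam) powr t)"
      show "4 * (lam * (1 - lam)) powr t \<le> ?\<rho>" by simp
      show "?\<rho> < 1" using half four_branch_ratio_powr_less[OF t] by simp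
      show "\<Lambda> \<inter> W lam 1 = {} \<or> 2 * (1 - lam) powr t \<le> ?\<rho>" by simp
      show "F lam x \<in> \<Lambda>" if "x \<in> \<Lambda>" for x using \<Lambda>(3) that by blast
      fix n :: nat assume n: "1 \<le> n"
      show "\<Lambda> \<inter> W lam n = {} \<or> (lam ^ (n - 1)) powr t \<le> 2 ^ N * (1/2) ^ n"
      proof (cases "n \<le> N")
        case True
        have "(lam ^ (n - 1)) powr t \<le> 1"
          using lam \<open>0 < t\<close> by (intro powr_le1) (auto intro: power_le_one)
        also have "1 \<le> (2::real) ^ (N - n)" by simp
        also have "\<dots> = 2 ^ N * (1/2) ^ n" using True by (simp add: power_diff power_one_over)
        finally show ?thesis by simp
      next
        case False
        then have "lam ^ (n - 1) \<le> lam ^ N" using lam by (intro power_decreasing) auto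
        then have "x \<notin> W lam n" if "x \<in> \<Lambda>" for x using \<epsilon>(2)[OF that] N by (auto simp: W_def)
        then show ?thesis by blast
      qed
    qed
  qed (use crit_exp_pos in simp)
qed

text \<open>\<open>F lam\<close> is discontinuous, but only finitely many levels meet
  \<open>{\<epsilon>..1}\<close>, and each affine branch extends continuously to the closed
  interval.\<close>

lemma closed_F_preimage:
  assumes "closed K" "K \<subseteq> {\<epsilon>..1}" "0 < \<epsilon>"
  shows "closed {x \<in> {\<epsilon>..1}. F lam x \<in> K}"
proof -
  obtain N where N: "lam ^ N < \<epsilon>" using real_arch_pow_inv[OF assms(3) lam(2)] by blast
  let ?I = "\<lambda>n. {lam ^ n..lam ^ (n - 1)} \<inter> (\<lambda>x. (x - lam ^ n) / contraction lam n) -` K"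
  have "{x \<in> {\<epsilon>..1}. F lam x \<in> K} = {\<epsilon>..1} \<inter> (\<Union>n\<in>{1..N}. ?I n)"
  proof (intro equalityI subsetI)
    fix x assume x: "x \<in> {x \<in> {\<epsilon>..1}. F lam x \<in> K}"
    then have "x \<in> {0<..1}" using \<open>0 < \<epsilon>\<close> by auto
    then obtain n where n: "1 \<le> n" "x \<in> W lam n" using W_obtain[OF lam] by metis
    have "n \<le> N"
    proof (rule ccontr)
      assume "\<not> n \<le> N"
      then have "lam ^ (n - 1) \<le> lam ^ N" using lam by (intro power_decreasing) auto
      moreover have "x \<le> lam ^ (n - 1)" "\<epsilon> \<le> x" using n x by (auto simp: W_def)
      ultimately show False using N by linarith
    qed
    moreover have "x \<in> ?I n" using n x F_eq_contraction[OF lam n] by (auto simp: W_def)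
    ultimately show "x \<in> {\<epsilon>..1} \<inter> (\<Union>n\<in>{1..N}. ?I n)" using n x by auto
  next
    fix x assume "x \<in> {\<epsilon>..1} \<inter> (\<Union>n\<in>{1..N}. ?I n)"
    then obtain n where n: "1 \<le> n" "x \<in> ?I n" and x: "x \<in> {\<epsilon>..1}" by auto
    \<comment> \<open>The excluded left endpoint of \<open>W\<close> would be mapped to \<open>0\<close>, which is not in \<open>K\<close>.\<close>
    have "x \<noteq> lam ^ n" using n assms(2,3) by auto
    then have "x \<in> W lam n" using n by (auto simp: W_def)
    then show "x \<in> {x \<in> {\<epsilon>..1}. F lam x \<in> K}"
      using x n F_eq_contraction[OF lam n(1)] by auto
  qed
  moreover have "closed (?I n)" for n
    using contraction_bounds(1)[OF lam, of n]
    by (intro closed_Int closed_vimage assms(1)) (auto intro!: continuous_intros)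
  then have "closed ({\<epsilon>..1} \<inter> (\<Union>n\<in>{1..N}. ?I n))"
    by (intro closed_Int[OF closed_atLeastAtMost] closed_UN) auto
  ultimately show ?thesis by (simp only:)
qed

text \<open>The points whose iterates up to time \<open>k\<close> stay in
  \<open>{\<epsilon>..1}\<close> form a closed set, by pulling back one step at a time; then
  intersect over \<open>k\<close>.\<close>

lemma compact_bounded_orbits:
  assumes "0 < \<epsilon>"
  shows "compact {x. \<forall>k. (F lam ^^ k) x \<in> {\<epsilon>..1}}"
proof -
  let ?K = "\<lambda>k. {x. \<forall>i\<in>{..k}. (F lam ^^ i) x \<in> {\<epsilon>..1}}"
  have closed: "closed (?K k)" for k
  proof (induction k)
    case (Suc k)
    have "?K (Suc k) = {x \<in> {\<epsilon>..1}. F lam x \<in> ?K k}"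
      unfolding atMost_Suc_eq_insert_0 by (auto simp: funpow_swap1)
    moreover have "?K k \<subseteq> {\<epsilon>..1}"
    proof
      fix x assume "x \<in> ?K k"
      then have "(F lam ^^ 0) x \<in> {\<epsilon>..1}" by blast
      then show "x \<in> {\<epsilon>..1}" by simp
    qed
    ultimately show ?case using closed_F_preimage[OF Suc.IH _ assms] by simp
  next
    case 0
    have "?K 0 = {\<epsilon>..1}" by auto
    then show ?case by simp
  qed
  have "{x. \<forall>k. (F lam ^^ k) x \<in> {\<epsilon>..1}} = ?K 0 \<inter> (\<Inter>k. ?K k)" by blast
  also have "?K 0 = {\<epsilon>..1}" by auto
  finally have "{x. \<forall>k. (F lam ^^ k) x \<in> {\<epsilon>..1}} = {\<epsilon>..1} \<inter> (\<Inter>k. ?K k)" .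
  moreover have "compact ({\<epsilon>..1} \<inter> (\<Inter>k. ?K k))"
    using closed by (intro compact_Int_closed closed_INT) auto
  ultimately show ?thesis by simp
qed

text \<open>\<open>A\<close> itself may fail to be compact or invariant, but the set of all points
  whose orbit stays in \<open>{\<epsilon>..1}\<close> contains it and is admissible in the
  supremum.\<close>

lemma hausdorff_dim_le_hyperbolic_dim:
  assumes "0 < \<epsilon>" "\<And>x k. x \<in> A \<Longrightarrow> (F lam ^^ k) x \<in> {\<epsilon>..1}"
  shows "hausdorff_dim A \<le> hyperbolic_dim (F lam)"
proof -
  let ?\<Lambda> = "{x. \<forall>k. (F lam ^^ k) x \<in> {\<epsilon>..1}}"
  have "(F lam ^^ k) (F lam x) \<in> {\<epsilon>..1}" if "x \<in> ?\<Lambda>" for x k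
  proof -
    have "(F lam ^^ Suc k) x \<in> {\<epsilon>..1}" using that by blast
    then show ?thesis by (simp add: funpow_swap1)
  qed
  then have "F lam ` ?\<Lambda> \<subseteq> ?\<Lambda>" by blast
  moreover have "?\<Lambda> \<subseteq> {0<..1}"
  proof
    fix x assume "x \<in> ?\<Lambda>"
    then have "(F lam ^^ 0) x \<in> {\<epsilon>..1}" by blast
    then show "x \<in> {0<..1}" using assms(1) by simp
  qed
  ultimately have "hausdorff_dim ?\<Lambda> \<le> hyperbolic_dim (F lam)"
    unfolding hyperbolic_dim_def using compact_bounded_orbits[OF assms(1)] by (intro Sup_upper) blast
  moreover have "hausdorff_dim A \<le> hausdorff_dim ?\<Lambda>"
    using assms(2) by (intro hausdorff_dim_mono) blast
  ultimately show ?thesis by (rule order_trans[rotated])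
qed

end

section \<open>The upper bound 1\<close>

lemma hyperbolic_dim_le_1: "hyperbolic_dim f \<le> 1"
  unfolding hyperbolic_dim_def
  by (rule Sup_least) (use hausdorff_dim_mono hausdorff_dim_unit_interval_le in \<open>blast intro: order_trans\<close>)

lemma escaping_dim_le_1: "hausdorff_dim (escaping_set lam) \<le> 1"
proof -
  have "hausdorff_dim (escaping_set lam) \<le> hausdorff_dim {0<..1::real}"
    by (rule hausdorff_dim_mono) (auto simp: escaping_set_def)
  then show ?thesis using hausdorff_dim_unit_interval_le by (rule order_trans)
qed

subsection \<open>Coding of orbits\<close>

text \<open>A position relative to the left endpoint of its level: the point of
  \<open>W lam (l + 1)\<close> with future jumps \<open>j\<close> is
  \<open>lam ^ Suc l * code lam j\<close>, so one series serves all levels.\<close>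

definition code :: "real \<Rightarrow> (nat \<Rightarrow> nat) \<Rightarrow> real" where
  "code lam j = (\<Sum>k. (1 - lam) ^ k * lam ^ (\<Sum>i<k. j i))"

text \<open>Truncated subtraction makes level \<open>0\<close> reflecting; level \<open>l\<close> stands for the interval
  \<open>W lam (l + 1)\<close>.\<close>

primrec level :: "(nat \<Rightarrow> nat) \<Rightarrow> nat \<Rightarrow> nat" where
  "level j 0 = 0"
| "level j (Suc t) = (level j t - 1) + j t"

definition block_sum :: "nat \<Rightarrow> nat \<Rightarrow> (nat \<Rightarrow> nat) \<Rightarrow> bool" where
  "block_sum m J j \<longleftrightarrow> (\<forall>k. (\<Sum>i<m. j (m * k + i)) = J)"

lemma sum_lessThan_add:
  fixes f :: "nat \<Rightarrow> nat"
  shows "(\<Sum>i<a + b. f i) = (\<Sum>i<a. f i) + (\<Sum>i<b. f (a + i))"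
  by (induction b) auto

lemma block_sum_prefix:
  assumes "block_sum m J j"
  shows "(\<Sum>i<m * k. j i) = J * k"
proof (induction k)
  case (Suc k)
  have "(\<Sum>i<m * Suc k. j i) = (\<Sum>i<m * k. j i) + (\<Sum>i<m. j (m * k + i))"
    by (metis add.commute mult_Suc_right sum_lessThan_add)
  then show ?case using Suc assms by (simp add: block_sum_def)
qed simp

lemma block_sum_bound:
  assumes "block_sum m J j" "0 < m"
  shows "j t \<le> J"
proof -
  have "j t = j (m * (t div m) + t mod m)" by simp
  also have "\<dots> \<le> (\<Sum>i<m. j (m * (t div m) + i))"
    using assms(2) by (intro member_le_sum) auto
  finally show ?thesis using assms(1) by (simp add: block_sum_def)
qed

text \<open>Making all \<open>i\<close> decreases before all the jumps truncates the most, and thus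
  can only give a higher final level.\<close>

lemma level_add_le: "level j (t + i) \<le> (level j t - i) + (\<Sum>u<i. j (t + u))"
  by (induction i) auto

text \<open>At block ends the level is at most \<open>J\<close>, because a block takes away
  \<open>m \<ge> J\<close> and adds \<open>J\<close>; within a block at most another
  \<open>J\<close> is added.\<close>

lemma level_bounded:
  assumes "block_sum m J j" "0 < m" "J \<le> m"
  shows "level j t \<le> 2 * J"
proof -
  have blocks: "level j (m * k) \<le> J" for k
  proof (induction k)
    case (Suc k)
    have "level j (m * k + m) \<le> (level j (m * k) - m) + J"
      using level_add_le[of j "m * k" m] assms(1) by (simp add: block_sum_def)
    then show ?case using Suc assms(3) by (simp add: add.commute)
  qed simp
  let ?k = "t div m" and ?i = "t mod m"
  have "(\<Sum>u<?i. j (m * ?k + u)) \<le> (\<Sum>u<m. j (m * ?k + u))"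
    using assms(2) by (intro sum_mono2) auto
  then have "(\<Sum>u<?i. j (m * ?k + u)) \<le> J" using assms(1) by (simp add: block_sum_def)
  then show ?thesis using level_add_le[of j "m * ?k" ?i] blocks[of ?k] by simp
qed

text \<open>Each step lowers the level by at most one before its jump is added.\<close>

lemma sum_le_level: "(\<Sum>i<t. j i) \<le> level j t + t"
  by (induction t) auto

lemma level_filterlim:
  assumes "block_sum m J j" "0 < m" "m < J"
  shows "filterlim (level j) at_top sequentially"
proof -
  \<comment> \<open>Each full block has net gain at least \<open>J - m \<ge> 1\<close>, and the
    unfinished last block loses at most \<open>m\<close>.\<close>
  have "t div m - m \<le> level j t" for t
  proof -
    let ?k = "t div m"
    have "(m + 1) * ?k \<le> J * ?k" by (rule mult_right_mono) (use assms(3) in simp_all)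
    moreover have "(\<Sum>i<m * ?k. j i) \<le> (\<Sum>i<t. j i)" by (rule sum_mono2) auto
    moreover have "(\<Sum>i<t. j i) \<le> level j t + t" by (rule sum_le_level)
    ultimately have "m * ?k + ?k \<le> level j t + t"
      unfolding block_sum_prefix[OF assms(1)] by (simp only: distrib_right mult_1)
    moreover have "t < m * ?k + m"
      using mult_div_mod_eq[of m t] mod_less_divisor[OF assms(2), of t] by linarith
    ultimately show ?thesis by linarith
  qed
  then have "\<forall>\<^sub>F t in sequentially. t div m - m \<le> level j t" by simp
  moreover have "filterlim (\<lambda>t. t div m - m) at_top sequentially"
    unfolding filterlim_at_top eventually_sequentially
  proof (intro allI exI impI)
    fix Z t :: nat assume "m * (Z + m) \<le> t"
    then have "m * (Z + m) div m \<le> t div m" by (rule div_le_mono)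
    then show "Z \<le> t div m - m" using assms(2) by simp
  qed
  ultimately show ?thesis by (rule filterlim_at_top_mono[rotated])
qed

section \<open>Points with prescribed jumps\<close>

context
  fixes lam :: real
  assumes lam: "0 < lam" "lam < 1"
begin

lemma code_summable: "summable (\<lambda>k. (1 - lam) ^ k * lam ^ (\<Sum>i<k. j i))"
proof (rule summable_comparison_test)
  show "\<exists>N. \<forall>k\<ge>N. norm ((1 - lam) ^ k * lam ^ (\<Sum>i<k. j i)) \<le> (1 - lam) ^ k"
    using lam by (auto simp: abs_mult intro!: mult_left_le power_le_one)
  show "summable (\<lambda>k. (1 - lam) ^ k)" using lam by (intro summable_geometric) auto
qed

lemma code_rec: "code lam j = 1 + (1 - lam) * lam ^ j 0 * code lam (\<lambda>i. j (Suc i))"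
proof -
  have "code lam j = (\<Sum>k. (1 - lam) ^ Suc k * lam ^ (\<Sum>i<Suc k. j i)) + 1"
    using suminf_split_head[OF code_summable[of j]] by (simp add: code_def)
  also have "(\<lambda>k. (1 - lam) ^ Suc k * lam ^ (\<Sum>i<Suc k. j i))
      = (\<lambda>k. ((1 - lam) * lam ^ j 0) * ((1 - lam) ^ k * lam ^ (\<Sum>i<k. j (Suc i))))"
    unfolding sum.lessThan_Suc_shift by (simp add: power_add mult_ac)
  also have "(\<Sum>k. ((1 - lam) * lam ^ j 0) * ((1 - lam) ^ k * lam ^ (\<Sum>i<k. j (Suc i))))
      = (1 - lam) * lam ^ j 0 * code lam (\<lambda>i. j (Suc i))"
    unfolding code_def by (rule suminf_mult[OF code_summable])
  finally show ?thesis by simp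
qed

lemma code_ge_1: "1 \<le> code lam j"
proof -
  have "0 \<le> code lam (\<lambda>i. j (Suc i))"
    unfolding code_def using lam by (intro suminf_nonneg code_summable) auto
  then show ?thesis using lam by (subst code_rec) simp
qed

text \<open>The second term of the series gives a gap above 1. It keeps points off the excluded left
  endpoint of their level and separates cylinders.\<close>

lemma code_gt: "1 + (1 - lam) * lam ^ j 0 \<le> code lam j"
  using code_ge_1[of "\<lambda>i. j (Suc i)"] lam
  by (subst code_rec) (auto intro!: mult_left_mono[of 1, simplified])

lemma code_le: "code lam j \<le> 1 / lam"
proof -
  have "code lam j \<le> (\<Sum>k. (1 - lam) ^ k)"
    unfolding code_def using lam
    by (intro suminf_le code_summable summable_geometric) (auto intro!: mult_left_le power_le_one)
  also have "\<dots> = 1 / lam" using lam by (subst suminf_geometric) auto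
  finally show ?thesis .
qed

lemma code_in_W: "lam ^ Suc l * code lam j \<in> W lam (Suc l)"
proof -
  have "0 < (1 - lam) * lam ^ j 0" using lam by simp
  then have "1 < code lam j" using code_gt[of j] by linarith
  moreover have "lam * code lam j \<le> 1"
    using code_le[of j] lam by (simp add: pos_le_divide_eq mult.commute)
  ultimately show ?thesis
    using lam mult_left_mono[of "lam * code lam j" 1 "lam ^ l"] by (simp add: W_def mult_ac)
qed

text \<open>\<open>F lam\<close> acts as the shift on jump sequences. The branches at
  \<open>l = 0\<close> and \<open>l > 0\<close> differ by a factor \<open>lam\<close>, which is
  exactly what the truncated \<open>l - 1\<close> accounts for.\<close>

lemma F_code:
  "F lam (lam ^ Suc l * code lam j) = lam ^ Suc ((l - 1) + j 0) * code lam (\<lambda>i. j (Suc i))"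
proof -
  let ?y = "code lam (\<lambda>i. j (Suc i))"
  have "F lam (lam ^ Suc l * code lam j) = (lam ^ Suc l * code lam j - lam ^ Suc l) / contraction lam (Suc l)"
    by (rule F_eq_contraction[OF lam _ code_in_W]) simp
  also have "lam ^ Suc l * code lam j - lam ^ Suc l = lam ^ Suc l * (1 - lam) * lam ^ j 0 * ?y"
    by (subst code_rec) (simp add: algebra_simps)
  also have "\<dots> = contraction lam (Suc l) * (lam ^ Suc ((l - 1) + j 0) * ?y)"
    by (cases l) (auto simp: contraction_def power_add)
  finally show ?thesis using contraction_bounds(1)[OF lam, of "Suc l"] by simp
qed

lemma F_funpow_code:
  "(F lam ^^ t) (lam * code lam j) = lam ^ Suc (level j t) * code lam (\<lambda>i. j (t + i))"
proof (induction t)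
  case (Suc t)
  have "(F lam ^^ Suc t) (lam * code lam j) = F lam (lam ^ Suc (level j t) * code lam (\<lambda>i. j (t + i)))"
    using Suc by simp
  also have "\<dots> = lam ^ Suc (level j (Suc t)) * code lam (\<lambda>i. j (Suc t + i))"
    by (subst F_code) simp
  finally show ?case .
qed simp

lemma code_orbit_bounded_below:
  assumes "block_sum m J j" "0 < m" "J \<le> m"
  shows "(F lam ^^ t) (lam * code lam j) \<in> {lam ^ Suc (2 * J)..1}"
proof -
  let ?n = "Suc (level j t)"
  have "lam ^ Suc (2 * J) \<le> lam ^ ?n"
    using level_bounded[OF assms, of t] lam by (intro power_decreasing) auto
  moreover have "lam ^ ?n * code lam (\<lambda>i. j (t + i)) \<in> W lam ?n" by (rule code_in_W)
  moreover have "lam ^ (?n - 1) \<le> 1" using lam by (intro power_le_one) auto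
  ultimately show ?thesis unfolding F_funpow_code by (auto simp: W_def simp del: power_Suc)
qed

lemma code_escaping:
  assumes "block_sum m J j" "0 < m" "m < J"
  shows "lam * code lam j \<in> escaping_set lam"
proof -
  have "lam ^ Suc 0 * code lam j \<in> W lam (Suc 0)" by (rule code_in_W)
  then have "lam * code lam j \<in> {0<..1}" using lam by (auto simp: W_def)
  moreover have "(\<lambda>t. (F lam ^^ t) (lam * code lam j)) \<longlonglongrightarrow> 0"
  proof (rule tendsto_sandwich)
    have W: "(F lam ^^ t) (lam * code lam j) \<in> W lam (Suc (level j t))" for t
      unfolding F_funpow_code by (rule code_in_W)
    have "0 \<le> (F lam ^^ t) (lam * code lam j)" for t
    proof -
      have "0 < lam ^ Suc (level j t)" using lam by simp
      then show ?thesis using W[of t] unfolding W_def by simp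
    qed
    then show "\<forall>\<^sub>F t in sequentially. 0 \<le> (F lam ^^ t) (lam * code lam j)" by simp
    show "\<forall>\<^sub>F t in sequentially. (F lam ^^ t) (lam * code lam j) \<le> lam ^ level j t"
      using W by (simp add: W_def)
    show "(\<lambda>t. lam ^ level j t) \<longlonglongrightarrow> 0"
      using LIMSEQ_power_zero[of lam] lam level_filterlim[OF assms]
      by (auto intro: filterlim_compose[of "\<lambda>n. lam ^ n"])
  qed simp
  ultimately show ?thesis by (simp add: escaping_set_def)
qed

text \<open>The larger first jump gives at most \<open>lam ^ j 0\<close> after the bound
  \<open>1 / lam\<close> on codes, while the smaller one exceeds this value by the gap from
  \<open>code_gt\<close>.\<close>

lemma code_diff_first:
  assumes "j 0 < j' 0" "j 0 \<le> J" "j (Suc 0) \<le> J"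
  shows "(1 - lam) ^ 2 * lam ^ (2 * J) \<le> code lam j - code lam j'"
proof -
  let ?y = "code lam (\<lambda>i. j (Suc i))" and ?y' = "code lam (\<lambda>i. j' (Suc i))"
  have "lam ^ j' 0 * ?y' \<le> lam ^ Suc (j 0) * (1 / lam)"
    using lam assms(1) code_le code_ge_1[of "\<lambda>i. j' (Suc i)"]
    by (intro mult_mono power_decreasing) auto
  then have "lam ^ j' 0 * ?y' \<le> lam ^ j 0" using lam by simp
  moreover have "lam ^ j 0 * (1 + (1 - lam) * lam ^ j (Suc 0)) \<le> lam ^ j 0 * ?y"
    using code_gt[of "\<lambda>i. j (Suc i)"] lam by (intro mult_left_mono) auto
  ultimately have "lam ^ j 0 * ((1 - lam) * lam ^ j (Suc 0)) \<le> lam ^ j 0 * ?y - lam ^ j' 0 * ?y'"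
    by (simp add: algebra_simps)
  then have "(1 - lam) * (lam ^ j 0 * ((1 - lam) * lam ^ j (Suc 0)))
      \<le> (1 - lam) * (lam ^ j 0 * ?y - lam ^ j' 0 * ?y')"
    using lam by (intro mult_left_mono) auto
  also have "\<dots> = code lam j - code lam j'"
    by (subst code_rec[of j], subst code_rec[of j']) (simp add: algebra_simps)
  finally have *: "(1 - lam) ^ 2 * lam ^ (j 0 + j (Suc 0)) \<le> code lam j - code lam j'"
    by (simp add: power_add power2_eq_square mult_ac)
  have "lam ^ (2 * J) \<le> lam ^ (j 0 + j (Suc 0))"
    using lam assms by (intro power_decreasing) auto
  then have "(1 - lam) ^ 2 * lam ^ (2 * J) \<le> (1 - lam) ^ 2 * lam ^ (j 0 + j (Suc 0))"
    by (intro mult_left_mono) auto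
  then show ?thesis using * by linarith
qed

text \<open>A common prefix acts on both codes by the same affine map, so only the first different
  jump matters.\<close>

lemma code_separation:
  assumes "\<And>i. j i \<le> J" "\<And>i. j' i \<le> J" "\<And>i. i < t \<Longrightarrow> j i = j' i" "j t \<noteq> j' t"
  shows "(1 - lam) ^ t * lam ^ (\<Sum>i<t. j i) * ((1 - lam) ^ 2 * lam ^ (2 * J)) \<le> \<bar>code lam j - code lam j'\<bar>"
  using assms
proof (induction t arbitrary: j j')
  case 0
  then consider "j 0 < j' 0" | "j' 0 < j 0" by force
  then show ?case
  proof cases
    case 1
    have "(1 - lam) ^ 2 * lam ^ (2 * J) \<le> code lam j - code lam j'"
      using 1 "0.prems"(1) by (intro code_diff_first)
    then show ?thesis by simp
  next
    case 2
    have "(1 - lam) ^ 2 * lam ^ (2 * J) \<le> code lam j' - code lam j"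
      using 2 "0.prems"(2) by (intro code_diff_first)
    then show ?thesis by simp
  qed
next
  case (Suc t)
  let ?s = "\<lambda>i. j (Suc i)" and ?s' = "\<lambda>i. j' (Suc i)"
  have "(1 - lam) ^ t * lam ^ (\<Sum>i<t. ?s i) * ((1 - lam) ^ 2 * lam ^ (2 * J)) \<le> \<bar>code lam ?s - code lam ?s'\<bar>"
    using Suc.prems by (intro Suc.IH) auto
  then have "((1 - lam) * lam ^ j 0) * ((1 - lam) ^ t * lam ^ (\<Sum>i<t. ?s i) * ((1 - lam) ^ 2 * lam ^ (2 * J)))
      \<le> ((1 - lam) * lam ^ j 0) * \<bar>code lam ?s - code lam ?s'\<bar>"
    using lam by (intro mult_left_mono) auto
  also have "\<dots> = \<bar>((1 - lam) * lam ^ j 0) * (code lam ?s - code lam ?s')\<bar>"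
    using lam by (simp add: abs_mult)
  also have "((1 - lam) * lam ^ j 0) * (code lam ?s - code lam ?s') = code lam j - code lam j'"
    using Suc.prems(3)[of 0]
    by (subst (3) code_rec, subst (4) code_rec) (simp add: algebra_simps)
  finally show ?case unfolding sum.lessThan_Suc_shift by (simp add: power_add mult_ac)
qed

end

section \<open>Base \<open>N\<close> digits and the dimension of the coded set\<close>

definition digit :: "nat \<Rightarrow> real \<Rightarrow> nat \<Rightarrow> nat" where
  "digit N y k = nat (\<lfloor>real N ^ Suc k * y\<rfloor> mod int N)"

lemma digit_less: "0 < N \<Longrightarrow> digit N y k < N"
  by (simp add: digit_def nat_less_iff)

lemma digit_eq_imp_close:
  assumes "0 < N" "y \<in> {0..<1}" "z \<in> {0..<1}" "\<And>i. i < k \<Longrightarrow> digit N y i = digit N z i"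
  shows "\<bar>y - z\<bar> * real N ^ k \<le> 1"
proof -
  have "\<lfloor>real N ^ k * y\<rfloor> = \<lfloor>real N ^ k * z\<rfloor>"
    using assms(4)
  proof (induction k)
    case 0
    have "\<lfloor>y\<rfloor> = 0" "\<lfloor>z\<rfloor> = 0" using assms(2,3) by (auto simp: floor_eq_iff)
    then show ?case by simp
  next
    case (Suc k)
    \<comment> \<open>The scaled floor is thus rebuilt from the previous one and the new digit, so
      equal digits force equal floors.\<close>
    have div: "\<lfloor>real N ^ Suc k * x\<rfloor> div int N = \<lfloor>real N ^ k * x\<rfloor>" for x
      using floor_divide_real_eq_div[of "int N" "real N ^ Suc k * x"] assms(1) by simp
    have "\<lfloor>real N ^ Suc k * y\<rfloor> mod int N = \<lfloor>real N ^ Suc k * z\<rfloor> mod int N"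
      using Suc.prems[of k] assms(1) by (simp add: digit_def eq_nat_nat_iff)
    moreover have "\<lfloor>real N ^ k * y\<rfloor> = \<lfloor>real N ^ k * z\<rfloor>" using Suc by simp
    ultimately show ?case
      using div_mult_mod_eq[of "\<lfloor>real N ^ Suc k * y\<rfloor>" "int N"]
        div_mult_mod_eq[of "\<lfloor>real N ^ Suc k * z\<rfloor>" "int N"]
      unfolding div by argo
  qed
  then have "\<bar>real N ^ k * y - real N ^ k * z\<bar> < 1"
    using floor_correct[of "real N ^ k * y"] floor_correct[of "real N ^ k * z"] by linarith
  then have "\<bar>real N ^ k * (y - z)\<bar> \<le> 1" by (simp add: right_diff_distrib)
  then show ?thesis by (simp add: abs_mult mult.commute)
qed

lemma first_different_digit:
  assumes "2 \<le> N" "y \<in> {0..<1}" "z \<in> {0..<1}" "y \<noteq> z"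
  obtains k where "\<And>i. i < k \<Longrightarrow> digit N y i = digit N z i" "digit N y k \<noteq> digit N z k"
proof -
  have "\<exists>k. digit N y k \<noteq> digit N z k"
  proof (rule ccontr)
    assume "\<nexists>k. digit N y k \<noteq> digit N z k"
    then have close: "\<bar>y - z\<bar> * real N ^ k \<le> 1" for k
      using digit_eq_imp_close[of N y z k] assms by auto
    obtain k where "1 / \<bar>y - z\<bar> < real N ^ k"
      using real_arch_pow[of "real N" "1 / \<bar>y - z\<bar>"] assms(1) by auto
    then have "1 < \<bar>y - z\<bar> * real N ^ k" using assms(4) by (simp add: pos_divide_less_eq mult.commute)
    then show False using close[of k] by simp
  qed
  then have "digit N y (LEAST k. digit N y k \<noteq> digit N z k) \<noteq> digit N z (LEAST k. digit N y k \<noteq> digit N z k)"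
    by (rule LeastI_ex)
  then show ?thesis by (rule that[rotated]) (blast dest: not_less_Least)
qed

text \<open>By stars and bars there are \<open>N\<close> words of length \<open>m\<close> with sum
  \<open>J\<close>, and the base \<open>N\<close> digits of \<open>y\<close> choose the blocks.
  Parameters that first differ at digit \<open>k\<close> are at most \<open>1 / N ^ k\<close> apart,
  their points at least \<open>c * q ^ k\<close>; as \<open>N * q powr t \<ge> 1\<close>, the
  parametrization criterion applies.\<close>

lemma coded_set_dim_ge:
  fixes lam s :: real
  assumes lam: "0 < lam" "lam < 1" and "0 < m" "0 < s"
    and count: "1 \<le> real ((J + m - 1) choose J) * ((1 - lam) ^ m * lam ^ J) powr s"
    and A: "\<And>j. block_sum m J j \<Longrightarrow> lam * code lam j \<in> A"
  shows "ereal s \<le> hausdorff_dim A"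
proof (rule hausdorff_dim_ge)
  fix t assume t: "0 \<le> t" "t < s"
  define N where "N = (J + m - 1) choose J"
  define q where "q = (1 - lam) ^ m * lam ^ J"
  have "(1 - lam) ^ m < 1" using lam \<open>0 < m\<close> by (intro power_less_one_iff[THEN iffD2]) auto
  moreover have "q \<le> (1 - lam) ^ m"
    unfolding q_def using lam by (intro mult_left_le power_le_one) auto
  ultimately have "q < 1" by linarith
  moreover have "0 < q" using lam by (simp add: q_def)
  ultimately have q: "0 < q" "q < 1" by auto
  have "q powr s \<le> q powr t" using q t by (intro powr_mono') auto
  then have "real N * q powr s \<le> real N * q powr t" by (intro mult_left_mono) auto
  then have Nq: "1 \<le> real N * q powr t" using count by (simp add: N_def q_def)
  have "q powr s < 1" using q \<open>0 < s\<close> powr_less_mono'[of q 0 s] by simp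
  \<comment> \<open>With at most one word the counting hypothesis would fail, because
    \<open>q powr s < 1\<close>.\<close>
  have "2 \<le> N"
  proof (rule ccontr)
    assume "\<not> 2 \<le> N"
    then have "real N \<le> 1" by simp
    then have "real N * q powr s \<le> 1 * q powr s" by (intro mult_right_mono) auto
    then show False using count \<open>q powr s < 1\<close> by (simp add: N_def q_def)
  qed
  let ?words = "{w :: nat list. length w = m \<and> sum_list w = J}"
  have card: "card ?words = N" unfolding N_def by (rule card_length_sum_list)
  then have "finite ?words" using \<open>2 \<le> N\<close> by (intro card_ge_0_finite) auto
  then obtain w where w: "bij_betw w {0..<N} ?words"
    using ex_bij_betw_nat_finite card by metis
  define seq where "seq y i = w (digit N y (i div m)) ! (i mod m)" for y i
  have word: "w (digit N y k) \<in> ?words" for y k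
    using w digit_less[of N y k] \<open>2 \<le> N\<close> by (auto simp: bij_betw_def)
  have seq_nth: "seq y (m * k + i) = w (digit N y k) ! i" if "i < m" for y k i
    using that by (simp add: seq_def)
  have bs: "block_sum m J (seq y)" for y
    unfolding block_sum_def
  proof
    fix k
    have "(\<Sum>i<m. seq y (m * k + i)) = (\<Sum>i<m. w (digit N y k) ! i)"
      using seq_nth by (intro sum.cong) auto
    also have "\<dots> = sum_list (w (digit N y k))"
      using word[of y k] by (simp add: sum_list_sum_nth atLeast0LessThan)
    finally show "(\<Sum>i<m. seq y (m * k + i)) = J" using word[of y k] by simp
  qed
  \<comment> \<open>The extra factor \<open>q\<close> pays for the position of the first different
    jump inside block \<open>k\<close>; the rest is the scaling by \<open>lam\<close> and the
    separation constant of \<open>code_separation\<close>.\<close>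
  define c where "c = lam * q * ((1 - lam) ^ 2 * lam ^ (2 * J))"
  have c: "0 < c" using lam q by (simp add: c_def)
  show "hausdorff_measure t A \<noteq> 0"
  proof (rule hausdorff_measure_pos_if_param[where \<Phi> = "\<lambda>y. lam * code lam (seq y)" and C = "c powr - t"])
    show "lam * code lam (seq y) \<in> A" for y by (rule A[OF bs])
    fix y z :: real assume yz: "y \<in> {0..<1}" "z \<in> {0..<1}" "y \<noteq> z"
    obtain k where k: "\<And>i. i < k \<Longrightarrow> digit N y i = digit N z i" "digit N y k \<noteq> digit N z k"
      using first_different_digit[OF \<open>2 \<le> N\<close> yz] by blast
    have "w (digit N y k) \<noteq> w (digit N z k)"
      using k(2) w digit_less[of N _ k] \<open>2 \<le> N\<close> by (auto simp: bij_betw_def inj_on_def)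
    then have "\<exists>i<m. w (digit N y k) ! i \<noteq> w (digit N z k) ! i"
      using word[of y k] word[of z k] by (auto simp: list_eq_iff_nth_eq)
    then obtain i0 where i0: "i0 < m" "seq y (m * k + i0) \<noteq> seq z (m * k + i0)"
      using seq_nth by metis
    define T where "T = (LEAST i. seq y i \<noteq> seq z i)"
    have T: "seq y T \<noteq> seq z T" "T \<le> m * k + i0"
      unfolding T_def using i0(2) by (rule LeastI, rule Least_le)
    have eq: "seq y i = seq z i" if "i < T" for i
      using not_less_Least[of i "\<lambda>i. seq y i \<noteq> seq z i"] that by (simp add: T_def)
    have "T \<le> m * Suc k" using T(2) i0(1) by simp
    have "(\<Sum>i<T. seq y i) \<le> (\<Sum>i<m * Suc k. seq y i)"
      using \<open>T \<le> m * Suc k\<close> by (intro sum_mono2) auto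
    then have S: "(\<Sum>i<T. seq y i) \<le> J * Suc k" using block_sum_prefix[OF bs, of y "Suc k"] by simp
    have "q ^ Suc k = (1 - lam) ^ (m * Suc k) * lam ^ (J * Suc k)"
      by (simp only: q_def power_mult_distrib power_mult)
    also have "\<dots> \<le> (1 - lam) ^ T * lam ^ (\<Sum>i<T. seq y i)"
      using lam \<open>T \<le> m * Suc k\<close> S by (intro mult_mono power_decreasing) auto
    finally have "q ^ Suc k * ((1 - lam) ^ 2 * lam ^ (2 * J))
        \<le> (1 - lam) ^ T * lam ^ (\<Sum>i<T. seq y i) * ((1 - lam) ^ 2 * lam ^ (2 * J))"
      using lam by (intro mult_right_mono) auto
    also have "\<dots> \<le> \<bar>code lam (seq y) - code lam (seq z)\<bar>"
      using block_sum_bound[OF bs \<open>0 < m\<close>] eq T(1) by (intro code_separation lam)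
    finally have "lam * (q ^ Suc k * ((1 - lam) ^ 2 * lam ^ (2 * J)))
        \<le> lam * \<bar>code lam (seq y) - code lam (seq z)\<bar>"
      using lam by (intro mult_left_mono) auto
    also have "\<dots> = dist (lam * code lam (seq y)) (lam * code lam (seq z))"
      using lam by (simp add: dist_real_def abs_mult flip: right_diff_distrib)
    finally have "c * q ^ k \<le> dist (lam * code lam (seq y)) (lam * code lam (seq z))" (is "_ \<le> ?d")
      by (simp add: c_def mult_ac)
    then have "q ^ k \<le> ?d / c" using c by (simp add: pos_le_divide_eq mult.commute)
    then have "(q ^ k) powr t \<le> (?d / c) powr t" using q t by (intro powr_mono2) auto
    also have "\<dots> = c powr - t * ?d powr t"
      using c by (simp add: powr_divide powr_minus_divide)
    finally have qd: "(q powr t) ^ k \<le> c powr - t * ?d powr t"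
      using q by (simp add: power_powr)
    have "\<bar>y - z\<bar> * real N ^ k \<le> 1"
      using digit_eq_imp_close[OF _ yz(1,2) k(1)] \<open>2 \<le> N\<close> by simp
    also have "1 \<le> (real N * q powr t) ^ k" using Nq by (rule one_le_power)
    also have "\<dots> = (q powr t) ^ k * real N ^ k" by (simp add: power_mult_distrib mult.commute)
    finally have "\<bar>y - z\<bar> \<le> (q powr t) ^ k"
      using \<open>2 \<le> N\<close> by simp
    then show "\<bar>y - z\<bar> \<le> c powr - t * ?d powr t" using qd by linarith
  qed (use t c in auto)
qed

subsection \<open>Counting blocks\<close>

text \<open>The \<open>Suc M\<close> binomial probabilities add up to 1.\<close>

lemma binomial_weight_ge_average:
  fixes p :: real
  assumes "0 < p" "p < 1"
  shows "\<exists>k\<le>M. 1 / real (Suc M) \<le> real (M choose k) * (p ^ k * (1 - p) ^ (M - k))"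
proof (rule ccontr)
  assume "\<not> ?thesis"
  then have less: "real (M choose k) * (p ^ k * (1 - p) ^ (M - k)) < 1 / real (Suc M)" if "k \<le> M" for k
    using that by force
  have "1 = (p + (1 - p)) ^ M" by simp
  also have "\<dots> = (\<Sum>k\<le>M. real (M choose k) * p ^ k * (1 - p) ^ (M - k))" by (rule binomial_ring)
  also have "\<dots> < (\<Sum>k\<le>M. 1 / real (Suc M))"
    using less by (intro sum_strict_mono) (auto simp: mult.assoc)
  also have "\<dots> = 1" by simp
  finally show False by simp
qed

text \<open>If the index found by averaging is below \<open>h\<close>, reflect it to
  \<open>2 * h - k\<close>: the coefficient is the same and, for \<open>p \<ge> 1/2\<close>, the
  weight does not decrease.\<close>

lemma binomial_weight_upper_half:
  fixes p :: real
  assumes "0 < p" "p < 1" "1/2 \<le> p"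
  shows "\<exists>k. h \<le> k \<and> k \<le> 2 * h \<and> 1 / real (Suc (2 * h)) \<le> real ((2 * h) choose k) * (p ^ k * (1 - p) ^ (2 * h - k))"
proof -
  obtain k where k: "k \<le> 2 * h" "1 / real (Suc (2 * h)) \<le> real ((2 * h) choose k) * (p ^ k * (1 - p) ^ (2 * h - k))"
    using binomial_weight_ge_average[OF assms(1,2), of "2 * h"] by blast
  show ?thesis
  proof (cases "h \<le> k")
    case False
    have "(1 - p) ^ (2 * h - 2 * k) \<le> p ^ (2 * h - 2 * k)" using assms by (intro power_mono) auto
    then have "(p ^ k * (1 - p) ^ k) * (1 - p) ^ (2 * h - 2 * k) \<le> (p ^ k * (1 - p) ^ k) * p ^ (2 * h - 2 * k)"
      using assms by (intro mult_left_mono) auto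
    moreover have split: "x ^ (2 * h - k) = x ^ k * x ^ (2 * h - 2 * k)" for x :: real
    proof -
      have "2 * h - k = k + (2 * h - 2 * k)" using False by simp
      then show ?thesis by (metis power_add)
    qed
    ultimately have "p ^ k * (1 - p) ^ (2 * h - k) \<le> p ^ (2 * h - k) * (1 - p) ^ k"
      unfolding split by (simp only: mult_ac)
    then have "real ((2 * h) choose k) * (p ^ k * (1 - p) ^ (2 * h - k))
        \<le> real ((2 * h) choose (2 * h - k)) * (p ^ (2 * h - k) * (1 - p) ^ (2 * h - (2 * h - k)))"
      using k(1) binomial_symmetric[OF k(1)] by (simp add: mult_left_mono)
    then show ?thesis using k False by (intro exI[of _ "2 * h - k"]) auto
  qed (use k in blast)
qed

lemma binomial_weight_lower_half:
  fixes p :: real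
  assumes "0 < p" "p < 1" "p \<le> 1/2"
  shows "\<exists>k\<le>h. 1 / real (Suc (2 * h)) \<le> real ((2 * h) choose k) * (p ^ k * (1 - p) ^ (2 * h - k))"
proof -
  obtain k where k: "h \<le> k" "k \<le> 2 * h"
    "1 / real (Suc (2 * h)) \<le> real ((2 * h) choose k) * ((1 - p) ^ k * (1 - (1 - p)) ^ (2 * h - k))"
    using binomial_weight_upper_half[of "1 - p" h] assms by auto
  then show ?thesis
    using binomial_symmetric[OF k(2)] by (intro exI[of _ "2 * h - k"]) (auto simp: mult.commute)
qed

text \<open>The central coefficient is the largest, hence at least
  \<open>4 ^ h / (2 * h + 1)\<close>, and \<open>(lam * (1 - lam)) powr crit_exp lam\<close> is
  1/4.\<close>

lemma central_binomial_crit_exp: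
  assumes "0 < lam" "lam < 1"
  shows "1 / real (Suc (2 * h)) \<le> real ((2 * h) choose h) * (lam ^ h * (1 - lam) ^ (2 * h - h)) powr crit_exp lam"
proof -
  obtain k where "1 / real (Suc (2 * h)) \<le> real ((2 * h) choose k) * ((1/2) ^ k * (1 - 1/2) ^ (2 * h - k))" "k \<le> 2 * h"
    using binomial_weight_ge_average[of "1/2" "2 * h"] by auto
  then have "1 / real (Suc (2 * h)) \<le> real ((2 * h) choose k) * (1/2) ^ (2 * h)"
    by (simp flip: power_add)
  also have "\<dots> \<le> real ((2 * h) choose h) * (1/2) ^ (2 * h)"
    using binomial_maximum'[of h k] by (intro mult_right_mono) auto
  also have "(1/2 :: real) ^ (2 * h) = (1/4) ^ h" by (simp add: power_mult power2_eq_square)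
  also have "\<dots> = ((lam * (1 - lam)) powr crit_exp lam) ^ h"
    by (simp only: branch_ratio_powr_crit_exp[OF assms])
  also have "\<dots> = (lam ^ h * (1 - lam) ^ (2 * h - h)) powr crit_exp lam"
    using branch_ratio(1)[OF assms] by (simp add: power_powr flip: power_mult_distrib)
  finally show ?thesis .
qed

text \<open>For the case \<open>b = 2\<close> below: raising the jump sum by 2 does not reduce the
  number of words.\<close>

lemma choose_shift2_ge: "(n choose k) \<le> (Suc (Suc n) choose Suc (Suc k))"
  by (simp add: binomial_Suc_Suc)

text \<open>Lowering the exponent from \<open>s0\<close> to \<open>s\<close> gains a factor
  exponential in \<open>h\<close>. It absorbs the linear loss \<open>2 * h + 1\<close> from
  averaging and the bounded cost \<open>c\<close> of one more step and \<open>b\<close> more units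
  of jump.\<close>

lemma block_count_eventually:
  fixes lam s s0 :: real
  assumes lam: "0 < lam" "lam < 1" and s: "0 < s" "s < s0" and b: "b = 0 \<or> b = 2"
  shows "\<exists>h. \<forall>k\<le>2 * h.
    1 / real (Suc (2 * h)) \<le> real ((2 * h) choose k) * (lam ^ k * (1 - lam) ^ (2 * h - k)) powr s0 \<longrightarrow>
    1 \<le> real ((k + b + (2 * h - k + 1) - 1) choose (k + b)) * ((1 - lam) ^ (2 * h - k + 1) * lam ^ (k + b)) powr s"
proof -
  define \<kappa> where "\<kappa> = max lam (1 - lam)"
  have \<kappa>: "0 < \<kappa>" "\<kappa> < 1" using lam by (auto simp: \<kappa>_def)
  \<comment> \<open>\<open>u \<le> \<kappa> ^ (2 * h)\<close> and \<open>s < s0\<close> make the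
    gain \<open>u powr (s - s0)\<close> at least \<open>B ^ h\<close>.\<close>
  define B where "B = \<kappa> powr (2 * (s - s0))"
  define c where "c = ((1 - lam) * lam ^ b) powr s"
  have "\<kappa> powr 0 < B" unfolding B_def using \<kappa> s by (intro powr_less_mono') auto
  then have "1 < B" using \<kappa> by simp
  have "0 < c" using lam by (simp add: c_def)
  have "\<forall>\<^sub>F h in sequentially. real (Suc (2 * h)) \<le> c * B ^ h"
    using \<open>1 < B\<close> \<open>0 < c\<close> by real_asymp
  then obtain h where h: "real (Suc (2 * h)) \<le> c * B ^ h" by (auto simp: eventually_sequentially)
  show ?thesis
  proof (intro exI allI impI)
    fix k assume k: "k \<le> 2 * h"
    define u where "u = lam ^ k * (1 - lam) ^ (2 * h - k)"
    assume avg: "1 / real (Suc (2 * h)) \<le> real ((2 * h) choose k) * (lam ^ k * (1 - lam) ^ (2 * h - k)) powr s0"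
    have "0 < u" using lam by (simp add: u_def)
    have "u \<le> \<kappa> ^ k * \<kappa> ^ (2 * h - k)"
      unfolding u_def using lam by (intro mult_mono power_mono) (auto simp: \<kappa>_def)
    also have "\<dots> = \<kappa> ^ (2 * h)" using k by (simp flip: power_add)
    finally have "u \<le> \<kappa> ^ (2 * h)" .
    then have "(\<kappa> ^ (2 * h)) powr (s - s0) \<le> u powr (s - s0)"
      using \<open>0 < u\<close> s by (intro powr_mono2') auto
    moreover have "(\<kappa> ^ (2 * h)) powr (s - s0) = B ^ h"
      using \<kappa> by (simp add: B_def powr_power powr_realpow[symmetric] powr_powr mult_ac)
    ultimately have "u powr s0 * B ^ h \<le> u powr s0 * u powr (s - s0)" by (intro mult_left_mono) auto
    then have us: "u powr s0 * B ^ h \<le> u powr s" by (simp flip: powr_add)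
    have "(2 * h) choose k \<le> (k + b + (2 * h - k + 1) - 1) choose (k + b)"
      using b k choose_shift2_ge[of "2 * h" k] by auto
    then have N: "real ((2 * h) choose k) \<le> real ((k + b + (2 * h - k + 1) - 1) choose (k + b))" (is "_ \<le> ?N")
      by simp
    have "1 = 1 / real (Suc (2 * h)) * real (Suc (2 * h))" by simp
    also have "\<dots> \<le> (real ((2 * h) choose k) * u powr s0) * (c * B ^ h)"
      using avg h by (intro mult_mono) (auto simp: u_def)
    also have "\<dots> = real ((2 * h) choose k) * (c * (u powr s0 * B ^ h))" by simp
    also have "\<dots> \<le> ?N * (c * u powr s)"
      using N us \<open>0 < c\<close> \<open>1 < B\<close> by (intro mult_mono mult_left_mono) auto
    also have "c * u powr s = ((1 - lam) * lam ^ b * u) powr s" by (simp add: c_def powr_mult)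
    also have "(1 - lam) * lam ^ b * u = (1 - lam) ^ (2 * h - k + 1) * lam ^ (k + b)"
      by (simp add: u_def power_add mult_ac)
    finally show "1 \<le> ?N * ((1 - lam) ^ (2 * h - k + 1) * lam ^ (k + b)) powr s" .
  qed
qed

section \<open>Lower bounds and conclusion\<close>

lemma ereal_le_if_all_less:
  assumes "0 < s0" "\<And>s. 0 < s \<Longrightarrow> s < s0 \<Longrightarrow> ereal s \<le> D"
  shows "ereal s0 \<le> D"
proof (rule ccontr)
  assume "\<not> ereal s0 \<le> D"
  then obtain s where s: "D < ereal s" "ereal s < ereal s0" using ereal_dense2[of D "ereal s0"] by force
  \<comment> \<open>The \<open>s\<close> found by density may be nonpositive; the maximum restores
    positivity and stays below \<open>s0\<close>.\<close>
  have "ereal (max s (s0 / 2)) \<le> D" using assms(1) s(2) by (intro assms(2)) auto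
  moreover have "ereal s \<le> ereal (max s (s0 / 2))" by simp
  ultimately show False using s(1) by (meson leD order_trans)
qed

text \<open>Blocks of length \<open>2 * h - k + 1\<close> with jump sum \<open>k\<close>: the
  restriction \<open>k \<le> h\<close> puts the jump sum below the length, so the orbits stay away
  from 0.\<close>

lemma hyperbolic_dim_ge:
  fixes lam s0 :: real
  assumes lam: "0 < lam" "lam < 1" and "0 < s0"
    and avg: "\<And>h. \<exists>k\<le>h. 1 / real (Suc (2 * h))
      \<le> real ((2 * h) choose k) * (lam ^ k * (1 - lam) ^ (2 * h - k)) powr s0"
  shows "ereal s0 \<le> hyperbolic_dim (F lam)"
proof (rule ereal_le_if_all_less[OF \<open>0 < s0\<close>])
  fix s assume s: "0 < s" "s < s0"
  obtain h where h: "\<And>k. k \<le> 2 * h \<Longrightarrow>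
    1 / real (Suc (2 * h)) \<le> real ((2 * h) choose k) * (lam ^ k * (1 - lam) ^ (2 * h - k)) powr s0 \<Longrightarrow>
    1 \<le> real ((k + 0 + (2 * h - k + 1) - 1) choose (k + 0)) * ((1 - lam) ^ (2 * h - k + 1) * lam ^ (k + 0)) powr s"
    using block_count_eventually[OF lam s, of 0] by blast
  obtain k where k: "k \<le> h" "1 / real (Suc (2 * h))
      \<le> real ((2 * h) choose k) * (lam ^ k * (1 - lam) ^ (2 * h - k)) powr s0"
    using avg[of h] by blast
  let ?m = "2 * h - k + 1" and ?J = "k + 0"
  let ?A = "{lam * code lam j | j. block_sum ?m ?J j}"
  have "ereal s \<le> hausdorff_dim ?A"
    using h[OF _ k(2)] k(1) by (intro coded_set_dim_ge[OF lam _ s(1), of ?m ?J]) auto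
  also have "\<dots> \<le> hyperbolic_dim (F lam)"
  proof (rule hausdorff_dim_le_hyperbolic_dim[OF lam])
    show "0 < lam ^ Suc (2 * ?J)" using lam by simp
    fix x t assume "x \<in> ?A"
    then show "(F lam ^^ t) x \<in> {lam ^ Suc (2 * ?J)..1}"
      using code_orbit_bounded_below[OF lam, of ?m ?J] k(1) by auto
  qed
  finally show "ereal s \<le> hyperbolic_dim (F lam)" .
qed

text \<open>With \<open>h \<le> k\<close>, two extra units of jump make the sum \<open>k + 2\<close>
  exceed the block length \<open>2 * h - k + 1\<close>, so the coded points escape.\<close>

lemma escaping_dim_ge:
  fixes lam s0 :: real
  assumes lam: "0 < lam" "lam < 1" and "0 < s0"
    and avg: "\<And>h. \<exists>k. h \<le> k \<and> k \<le> 2 * h \<and> 1 / real (Suc (2 * h))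
      \<le> real ((2 * h) choose k) * (lam ^ k * (1 - lam) ^ (2 * h - k)) powr s0"
  shows "ereal s0 \<le> hausdorff_dim (escaping_set lam)"
proof (rule ereal_le_if_all_less[OF \<open>0 < s0\<close>])
  fix s assume s: "0 < s" "s < s0"
  obtain h where h: "\<And>k. k \<le> 2 * h \<Longrightarrow>
    1 / real (Suc (2 * h)) \<le> real ((2 * h) choose k) * (lam ^ k * (1 - lam) ^ (2 * h - k)) powr s0 \<Longrightarrow>
    1 \<le> real ((k + 2 + (2 * h - k + 1) - 1) choose (k + 2)) * ((1 - lam) ^ (2 * h - k + 1) * lam ^ (k + 2)) powr s"
    using block_count_eventually[OF lam s, of 2] by blast
  obtain k where k: "h \<le> k" "k \<le> 2 * h" "1 / real (Suc (2 * h))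
      \<le> real ((2 * h) choose k) * (lam ^ k * (1 - lam) ^ (2 * h - k)) powr s0"
    using avg[of h] by blast
  let ?m = "2 * h - k + 1" and ?J = "k + 2"
  show "ereal s \<le> hausdorff_dim (escaping_set lam)"
  proof (rule coded_set_dim_ge[OF lam _ s(1), of ?m ?J])
    show "1 \<le> real ((?J + ?m - 1) choose ?J) * ((1 - lam) ^ ?m * lam ^ ?J) powr s" by (rule h[OF k(2,3)])
    show "lam * code lam j \<in> escaping_set lam" if "block_sum ?m ?J j" for j
      using code_escaping[OF lam that] k by simp
  qed simp
qed

text \<open>At exponent 1 the weights are binomial probabilities with parameter \<open>lam\<close>,
  and for \<open>lam \<ge> 1/2\<close> a large one lies at some \<open>k \<ge> h\<close>.\<close>

lemma escaping_dim_ge_1: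
  assumes lam: "0 < lam" "lam < 1" "1/2 \<le> lam"
  shows "1 \<le> hausdorff_dim (escaping_set lam)"
proof -
  have "ereal 1 \<le> hausdorff_dim (escaping_set lam)"
    using binomial_weight_upper_half[OF lam] lam by (intro escaping_dim_ge) auto
  then show ?thesis by (simp add: one_ereal_def)
qed

lemma hyperbolic_dim_ge_1:
  assumes lam: "0 < lam" "lam < 1" "lam \<le> 1/2"
  shows "1 \<le> hyperbolic_dim (F lam)"
proof -
  have "ereal 1 \<le> hyperbolic_dim (F lam)"
    using binomial_weight_lower_half[OF lam] lam by (intro hyperbolic_dim_ge) auto
  then show ?thesis by (simp add: one_ereal_def)
qed

text \<open>The central index \<open>k = h\<close> satisfies the constraint for escape, and also the
  one for bounded orbits used next.\<close>

lemma escaping_dim_ge_crit_exp: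
  assumes lam: "0 < lam" "lam < 1"
  shows "ereal (crit_exp lam) \<le> hausdorff_dim (escaping_set lam)"
proof (rule escaping_dim_ge[OF lam crit_exp_pos[OF lam]])
  fix h show "\<exists>k. h \<le> k \<and> k \<le> 2 * h \<and> 1 / real (Suc (2 * h))
      \<le> real ((2 * h) choose k) * (lam ^ k * (1 - lam) ^ (2 * h - k)) powr crit_exp lam"
    using central_binomial_crit_exp[OF lam, of h] by (intro exI[of _ h]) simp
qed

lemma hyperbolic_dim_ge_crit_exp:
  assumes lam: "0 < lam" "lam < 1"
  shows "ereal (crit_exp lam) \<le> hyperbolic_dim (F lam)"
proof (rule hyperbolic_dim_ge[OF lam crit_exp_pos[OF lam]])
  fix h show "\<exists>k\<le>h. 1 / real (Suc (2 * h))
      \<le> real ((2 * h) choose k) * (lam ^ k * (1 - lam) ^ (2 * h - k)) powr crit_exp lam"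
    using central_binomial_crit_exp[OF lam, of h] by (intro exI[of _ h]) simp
qed

theorem theorem3:
  fixes lam :: real
  assumes "0 < lam" and "lam < 1"
  shows "hyperbolic_dim (F (1 - lam)) = hausdorff_dim (escaping_set lam)
    \<and> (lam \<le> 1/2 \<longrightarrow> hausdorff_dim (escaping_set lam) = ereal (- (ln 4 / ln (lam * (1 - lam)))))
    \<and> (lam \<ge> 1/2 \<longrightarrow> hausdorff_dim (escaping_set lam) = 1)"
proof -
  \<comment> \<open>The bounds on the hyperbolic dimension are used at \<open>1 - lam\<close>, where
    their case conditions turn into those for the escaping set at \<open>lam\<close>.\<close>
  have \<mu>: "0 < 1 - lam" "1 - lam < 1" using assms by auto
  have lower: "hausdorff_dim (escaping_set lam) = ereal (crit_exp lam)"
    "hyperbolic_dim (F (1 - lam)) = ereal (crit_exp lam)" if "lam \<le> 1/2"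
    using escaping_dim_le_crit_exp[OF assms that] escaping_dim_ge_crit_exp[OF assms]
      hyperbolic_dim_le_crit_exp[OF \<mu>] hyperbolic_dim_ge_crit_exp[OF \<mu>] that
    by (auto simp: crit_exp_sym intro: antisym)
  have upper: "hausdorff_dim (escaping_set lam) = 1" "hyperbolic_dim (F (1 - lam)) = 1" if "1/2 \<le> lam"
    using escaping_dim_le_1[of lam] escaping_dim_ge_1[OF assms that]
      hyperbolic_dim_le_1[of "F (1 - lam)"] hyperbolic_dim_ge_1[OF \<mu>] that
    by (auto intro: antisym)
  show ?thesis
    using lower upper by (cases "lam \<le> 1/2") (auto simp: crit_exp_def)
qed

end
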